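(* Let $\xi=\delta Z$ with $Z\sim\mathcal N(0,I_D)$, $\delta\in(0,1)$. Assume that the singular values $\lambda_1>\dots>\lambda_D>0$ of $A$ are distinct and that, for some constant $C_\lambda>0$, $$\sum_{i=j}^D\lambda_i^2\le C_\lambda\,j\,\lambda_j^2,\qquad j=2,\dots,D.$$ Then there is a constant $C>0$ depending only on $C_\lambda$ (in particular not on $f$) such that for every $f\in\mathbb{R}^P$ $$\mathbb{E}\big[\|A(\widehat f_{\tau_{\mathfrak b}}-f)\|^2\big]\le2\,\mathbb{E}[A_{\tau_{\mathfrak b},\lambda}+S_{\tau_{\mathfrak b},\lambda}]\le C\inf_{s\ge\lambda_1^{-2}}\mathbb{E}\big[\|A(\widehat f_s^{\mathrm{SW}}-f)\|^2\big],$$ where $\widehat f_s^{\mathrm{SW}}=A^\dagger\big(1-\exp(-sx)\big)(AA^\top)Y$, $s\ge0$, is the Showalter (gradient flow) estimator. For fixed $A$ and $f\neq0$, the infimum on the right-hand side can be taken over all $s\ge0$ provided $\delta>0$ is sufficiently small.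
   Context: Model: $D\ge 3$ and $P\ge D$ are integers, $A\in\mathbb{R}^{D\times P}$ has rank $D$, $f\in\mathbb{R}^P$, $g=Af$, and $Y=g+\xi$ is observed. $\|\cdot\|$ is the Euclidean norm, $A^\dagger=A^\top(AA^\top)^{-1}$. $\lambda_i$ are the nonzero singular values of $A$ in decreasing order, $u_i$ the left singular vectors, $Y_i=\langle Y,u_i\rangle$; $d$ is the number of distinct singular values (here $d=D$). For a function $h$ on $[0,\infty)$ and $w\in\mathbb{R}^D$, $h(AA^\top)w=\sum_{i=1}^D h(\lambda_i^2)\langle w,u_i\rangle u_i$; an expression in $x$ followed by $(AA^\top)$ denotes the corresponding function of $x$ applied to $AA^\top$. Standing assumption: $\sum_{j:\lambda_j=\lambda_i}Y_j^2>0$ for all $i$ (this holds almost surely under Gaussian noise). Interpolated conjugate gradients: for $k=0,\dots,d$, $r_k$ is the unique minimiser of $\|p(AA^\top)Y\|^2$ over real polynomials $p$ of degree at most $k$ with $p(0)=1$. For $t=k+\alpha$, $k\in\{0,\dots,d-1\}$, $\alpha\in(0,1]$, $r_t=(1-\alpha)r_k+\alpha r_{k+1}$. For $t\in[0,d]$: $\widehat f_t=A^\dagger(I_D-r_t(AA^\top))Y$ and $R_t^2=\|A\widehat f_t-Y\|^2=\|r_t(AA^\top)Y\|^2$. For $t\in(0,d]$, $x_{1,t}$ is the smallest zero of $r_t$ on $[0,\infty)$ and $r_{t,<}(x)=r_t(x)\mathbf 1(x<x_{1,t})$; $r_{0,<}\equiv1$. Error terms: $S_{t,\lambda}=\|(1-r_{t,<})^{1/2}(AA^\top)\xi\|^2$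 and $A_{t,\lambda}=\|r_{t,<}^{1/2}(AA^\top)g\|^2+R_t^2-\|r_{t,<}^{1/2}(AA^\top)Y\|^2$. Balanced oracle: $\tau_{\mathfrak b}=\inf\{t\in[0,d]: A_{t,\lambda}\le S_{t,\lambda}\}$. *)

theory Defs
  imports
    "HOL-Probability.Probability"
    "Jordan_Normal_Form.DL_Rank"
    "Jordan_Normal_Form.Gauss_Jordan_Elimination"
begin

no_notation Finite_Cartesian_Product.vec_nth (infixl \<open>$\<close> 90)
no_notation inner (infix \<open>\<bullet>\<close> 70)
hide_const (open) Finite_Cartesian_Product.vec Finite_Cartesian_Product.mat
hide_type (open) Finite_Cartesian_Product.vec

definition vnorm :: "real vec \<Rightarrow> real" where
  "vnorm v = sqrt (v \<bullet> v)"

(* Meaningful for full row rank, where A A^T is invertible. *)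
definition pinv :: "real mat \<Rightarrow> real mat" where
  "pinv A = transpose_mat A * the (mat_inverse (A * transpose_mat A))"

(* The nonzero singular values lam 1 \<ge> lam 2 \<ge> ... with left singular vectors u i, for a matrix
   whose rank is its number of rows D. Singular values and vectors are indexed by 1..D; the entries
   of a vector are, as always in this library, indexed from 0. *)
definition left_singular_system ::
  "real mat \<Rightarrow> (nat \<Rightarrow> real) \<Rightarrow> (nat \<Rightarrow> real vec) \<Rightarrow> bool" where
  "left_singular_system A lam u \<longleftrightarrow>
     (let I = {1..dim_row A} in
       (\<forall>i\<in>I. 0 < lam i) \<and>
       (\<forall>i\<in>I. \<forall>j\<in>I. i \<le> j \<longrightarrow> lam j \<le> lam i) \<and>
       (\<forall>i\<in>I. u i \<in> carrier_vec (dim_row A)) \<and>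
       (\<forall>i\<in>I. \<forall>j\<in>I. u i \<bullet> u j = (if i = j then 1 else 0)) \<and>
       (\<exists>v. (\<forall>i\<in>I. v i \<in> carrier_vec (dim_col A)) \<and>
            (\<forall>i\<in>I. \<forall>j\<in>I. v i \<bullet> v j = (if i = j then 1 else 0)) \<and>
            (\<forall>i\<in>I. A *\<^sub>v v i = lam i \<cdot>\<^sub>v u i \<and>
                    transpose_mat A *\<^sub>v u i = lam i \<cdot>\<^sub>v v i)))"

(* h(A A^T) w, for w in R^D with D = dim_vec w. *)
definition fcalc ::
  "(nat \<Rightarrow> real) \<Rightarrow> (nat \<Rightarrow> real vec) \<Rightarrow> (real \<Rightarrow> real) \<Rightarrow> real vec \<Rightarrow> real vec" where
  "fcalc lam u h w =
     vec (dim_vec w) (\<lambda>k. \<Sum>i=1..dim_vec w. h ((lam i)\<^sup>2) * (w \<bullet> u i) * (u i $ k))"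

definition cg_feasible :: "nat \<Rightarrow> real poly \<Rightarrow> bool" where
  "cg_feasible k p \<longleftrightarrow> Polynomial.degree p \<le> k \<and> poly p 0 = 1"

(* The minimiser r_k exists uniquely for k \<le> num_sv lam D as soon as Y has a nonzero component in
   every eigenspace of A A^T; under Gaussian noise the exceptional Y form a null set. *)
definition cg_poly :: "(nat \<Rightarrow> real) \<Rightarrow> (nat \<Rightarrow> real vec) \<Rightarrow> real vec \<Rightarrow> nat \<Rightarrow> real poly" where
  "cg_poly lam u Y k =
     (THE p. cg_feasible k p \<and>
        (\<forall>q. cg_feasible k q \<longrightarrow>
           (vnorm (fcalc lam u (poly p) Y))\<^sup>2 \<le> (vnorm (fcalc lam u (poly q) Y))\<^sup>2))"

(* r_t for t = k + a with a in (0,1], that is k = ceiling t - 1. *)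
definition cg_interp :: "(nat \<Rightarrow> real) \<Rightarrow> (nat \<Rightarrow> real vec) \<Rightarrow> real vec \<Rightarrow> real \<Rightarrow> real poly" where
  "cg_interp lam u Y t =
     (if t \<le> 0 then cg_poly lam u Y 0
      else let k = nat (\<lceil>t\<rceil> - 1); a = t - real k
           in Polynomial.smult (1 - a) (cg_poly lam u Y k) + Polynomial.smult a (cg_poly lam u Y (Suc k)))"

definition cg_est ::
  "real mat \<Rightarrow> (nat \<Rightarrow> real) \<Rightarrow> (nat \<Rightarrow> real vec) \<Rightarrow> real vec \<Rightarrow> real \<Rightarrow> real vec" where
  "cg_est A lam u Y t = pinv A *\<^sub>v (Y - fcalc lam u (poly (cg_interp lam u Y t)) Y)"

definition cg_residual ::
  "real mat \<Rightarrow> (nat \<Rightarrow> real) \<Rightarrow> (nat \<Rightarrow> real vec) \<Rightarrow> real vec \<Rightarrow> real \<Rightarrow> real" where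
  "cg_residual A lam u Y t = vnorm (A *\<^sub>v cg_est A lam u Y t - Y)"

definition cg_zero :: "(nat \<Rightarrow> real) \<Rightarrow> (nat \<Rightarrow> real vec) \<Rightarrow> real vec \<Rightarrow> real \<Rightarrow> real" where
  "cg_zero lam u Y t = (LEAST x. 0 \<le> x \<and> poly (cg_interp lam u Y t) x = 0)"

definition cg_trunc ::
  "(nat \<Rightarrow> real) \<Rightarrow> (nat \<Rightarrow> real vec) \<Rightarrow> real vec \<Rightarrow> real \<Rightarrow> real \<Rightarrow> real" where
  "cg_trunc lam u Y t x =
     (if t = 0 then 1
      else if x < cg_zero lam u Y t then poly (cg_interp lam u Y t) x else 0)"

definition stoch_err ::
  "(nat \<Rightarrow> real) \<Rightarrow> (nat \<Rightarrow> real vec) \<Rightarrow> real vec \<Rightarrow> real vec \<Rightarrow> real \<Rightarrow> real" where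
  "stoch_err lam u g xi t =
     (vnorm (fcalc lam u (\<lambda>x. sqrt (1 - cg_trunc lam u (g + xi) t x)) xi))\<^sup>2"

definition approx_err ::
  "real mat \<Rightarrow> (nat \<Rightarrow> real) \<Rightarrow> (nat \<Rightarrow> real vec) \<Rightarrow> real vec \<Rightarrow> real vec \<Rightarrow> real \<Rightarrow> real" where
  "approx_err A lam u g xi t =
     (let Y = g + xi; h = (\<lambda>x. sqrt (cg_trunc lam u Y t x))
      in (vnorm (fcalc lam u h g))\<^sup>2 + (cg_residual A lam u Y t)\<^sup>2 - (vnorm (fcalc lam u h Y))\<^sup>2)"

(* The number d of distinct singular values. *)
definition num_sv :: "(nat \<Rightarrow> real) \<Rightarrow> nat \<Rightarrow> nat" where
  "num_sv lam D = card (lam ` {1..D})"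

definition balanced_oracle ::
  "real mat \<Rightarrow> (nat \<Rightarrow> real) \<Rightarrow> (nat \<Rightarrow> real vec) \<Rightarrow> real vec \<Rightarrow> real vec \<Rightarrow> real" where
  "balanced_oracle A lam u g xi =
     Inf {t \<in> {0..real (num_sv lam (dim_row A))}.
            approx_err A lam u g xi t \<le> stoch_err lam u g xi t}"

definition showalter_est ::
  "real mat \<Rightarrow> (nat \<Rightarrow> real) \<Rightarrow> (nat \<Rightarrow> real vec) \<Rightarrow> real vec \<Rightarrow> real \<Rightarrow> real vec" where
  "showalter_est A lam u Y s = pinv A *\<^sub>v fcalc lam u (\<lambda>x. 1 - exp (- s * x)) Y"

(* The law N(0, I_D), on functions supported on {..<D}. It is completed so that the values of
   cg_poly on the null set where the minimiser is not unique cannot affect measurability. *)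
definition std_gaussian :: "nat \<Rightarrow> (nat \<Rightarrow> real) measure" where
  "std_gaussian D =
     completion (PiM {..<D} (\<lambda>_. density lborel (\<lambda>x. ennreal (std_normal_density x))))"

(* The noise delta Z, with Z the identity on the sample space of std_gaussian D. *)
definition noise :: "nat \<Rightarrow> real \<Rightarrow> (nat \<Rightarrow> real) \<Rightarrow> real vec" where
  "noise D \<delta> \<omega> = \<delta> \<cdot>\<^sub>v vec D \<omega>"

definition cg_oracle_loss ::
  "real mat \<Rightarrow> (nat \<Rightarrow> real) \<Rightarrow> (nat \<Rightarrow> real vec) \<Rightarrow> real vec \<Rightarrow> real vec \<Rightarrow> real" where
  "cg_oracle_loss A lam u f xi =
     (let g = A *\<^sub>v f
      in (vnorm (A *\<^sub>v (cg_est A lam u (g + xi) (balanced_oracle A lam u g xi) - f)))\<^sup>2)"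

definition oracle_err ::
  "real mat \<Rightarrow> (nat \<Rightarrow> real) \<Rightarrow> (nat \<Rightarrow> real vec) \<Rightarrow> real vec \<Rightarrow> real vec \<Rightarrow> real" where
  "oracle_err A lam u f xi =
     (let g = A *\<^sub>v f; t = balanced_oracle A lam u g xi
      in approx_err A lam u g xi t + stoch_err lam u g xi t)"

definition showalter_risk ::
  "real mat \<Rightarrow> (nat \<Rightarrow> real) \<Rightarrow> (nat \<Rightarrow> real vec) \<Rightarrow> real vec \<Rightarrow> real \<Rightarrow> real \<Rightarrow> real" where
  "showalter_risk A lam u f \<delta> s =
     (\<integral>\<omega>. (vnorm (A *\<^sub>v (showalter_est A lam u (A *\<^sub>v f + noise (dim_row A) \<delta> \<omega>) s - f)))\<^sup>2
        \<partial>std_gaussian (dim_row A))"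

end

theory Submission
  imports Defs "HOL-Computational_Algebra.Fundamental_Theorem_Algebra"
begin

text \<open>
  Write \<open>x\<^sub>i = \<lambda>\<^sub>i\<^sup>2\<close> and expand everything in the left singular vectors. The residual polynomials are
  orthogonal for the weights \<open>x\<^sub>i Y\<^sub>i\<^sup>2\<close>, so the interpolants \<open>r\<^sub>t\<close> have only positive real zeros, and the
  truncated \<open>r\<^bsub>t,<\<^esub>\<close> decreases continuously in \<open>t\<close> and satisfies \<open>r\<^bsub>t,<\<^esub>(x) \<le> exp (- s x)\<close> and
  \<open>1 - r\<^bsub>t,<\<^esub>(x) \<le> min 1 (s x)\<close> with \<open>s = - r\<^sub>t'(0)\<close>. The approximation error at \<open>t\<close> is at most
  \<open>\<Sum>\<^sub>i r\<^bsub>t,<\<^esub>(x\<^sub>i) g\<^sub>i\<^sup>2\<close>, which decreases in \<open>t\<close>, while the stochastic error increases; at the balanced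
  oracle the two errors agree. Comparing the oracle with the index matched to a given \<open>s\<close> therefore yields
  the pathwise bound \<open>2 (\<Sum>\<^sub>i exp (- s x\<^sub>i) g\<^sub>i\<^sup>2 + \<Sum>\<^sub>i min 1 (s x\<^sub>i) \<xi>\<^sub>i\<^sup>2)\<close> for every \<open>s \<ge> 0\<close>. For \<open>s = 2 s'\<close> the
  first sum is the squared bias of the Showalter estimator at \<open>s'\<close>, and the decay condition on the singular
  values bounds the expectation of the second by its variance when \<open>s' \<ge> 1 / x\<^sub>1\<close>. For smaller \<open>s'\<close> the
  Showalter bias is still at least \<open>exp (- 2)\<close> times \<open>\<Sum>\<^sub>i g\<^sub>i\<^sup>2\<close>, which the pathwise bound at \<open>s = 0\<close> matches
  for every \<open>\<delta>\<close>.
\<close>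

section \<open>The conjugate gradient recursion\<close>

locale cg_recursion =
  fixes D :: nat and x w :: "nat \<Rightarrow> real"
begin

text \<open>
  Minimising \<open>\<Sum>\<^sub>i w\<^sub>i p(x\<^sub>i)\<^sup>2\<close> subject to \<open>p(0) = 1\<close> makes \<open>p\<close> orthogonal to \<open>x q\<close> for \<open>w\<close>, hence the
  extra factor \<open>x\<^sub>i\<close> in the inner product.
\<close>

definition ip :: "real poly \<Rightarrow> real poly \<Rightarrow> real" where
  "ip p q = (\<Sum>i=1..D. x i * w i * poly p (x i) * poly q (x i))"

definition energy :: "real poly \<Rightarrow> real" where
  "energy p = (\<Sum>i=1..D. w i * (poly p (x i))\<^sup>2)"

text \<open>The Hestenes-Stiefel recursion in polynomial form: a residual polynomial and its search
  direction. Starting from the recursion makes all values rational in the weights, as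
  \<open>measurable_res_dir\<close> exploits; \<open>res_unique_minimiser\<close> recovers the
  minimisation.\<close>

primrec cg_pair :: "nat \<Rightarrow> real poly \<times> real poly" where
  "cg_pair 0 = (1, 1)"
| "cg_pair (Suc k) =
     (let r = fst (cg_pair k); p = snd (cg_pair k);
          r' = r - Polynomial.smult (ip r r / ip (pCons 0 p) p) (pCons 0 p)
      in (r', r' + Polynomial.smult (ip r' r' / ip r r) p))"

definition res :: "nat \<Rightarrow> real poly" where "res k = fst (cg_pair k)"
definition dir :: "nat \<Rightarrow> real poly" where "dir k = snd (cg_pair k)"
definition step :: "nat \<Rightarrow> real" where
  "step k = ip (res k) (res k) / ip (pCons 0 (dir k)) (dir k)"
definition coupling :: "nat \<Rightarrow> real" where
  "coupling k = ip (res (Suc k)) (res (Suc k)) / ip (res k) (res k)"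

lemma res_0 [simp]: "res 0 = 1" and dir_0 [simp]: "dir 0 = 1"
  by (simp_all add: res_def dir_def)

lemma res_Suc: "res (Suc k) = res k - Polynomial.smult (step k) (pCons 0 (dir k))"
  by (simp add: res_def dir_def step_def Let_def)

lemma dir_Suc: "dir (Suc k) = res (Suc k) + Polynomial.smult (coupling k) (dir k)"
  by (simp add: res_def dir_def coupling_def Let_def)

lemma ip_commute: "ip p q = ip q p"
  by (simp add: ip_def mult_ac)

lemma ip_add_left: "ip (p + p') q = ip p q + ip p' q"
  by (simp add: ip_def algebra_simps sum.distrib)

lemma ip_diff_left: "ip (p - p') q = ip p q - ip p' q"
  by (simp add: ip_def algebra_simps sum_subtractf)

lemma ip_smult_left: "ip (Polynomial.smult c p) q = c * ip p q"
  by (simp add: ip_def sum_distrib_left mult_ac)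

lemma ip_zero_left [simp]: "ip 0 q = 0"
  by (simp add: ip_def)

lemma ip_add_right: "ip q (p + p') = ip q p + ip q p'"
  by (metis ip_commute ip_add_left)

lemma ip_diff_right: "ip q (p - p') = ip q p - ip q p'"
  by (metis ip_commute ip_diff_left)

lemma ip_smult_right: "ip q (Polynomial.smult c p) = c * ip q p"
  by (metis ip_commute ip_smult_left)

lemma ip_shift: "ip (pCons 0 p) q = ip p (pCons 0 q)"
  by (simp add: ip_def mult_ac)

lemmas ip_linear = ip_add_left ip_diff_left ip_smult_left ip_add_right ip_diff_right ip_smult_right

lemma poly_res_0 [simp]: "poly (res k) 0 = 1"
  by (induction k) (simp_all add: res_Suc)

lemma degree_res_dir: "Polynomial.degree (res k) \<le> k \<and> Polynomial.degree (dir k) \<le> k"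
proof (induction k)
  case (Suc k)
  have "Polynomial.degree (res (Suc k)) \<le> Suc k"
    unfolding res_Suc using Suc
    by (intro degree_diff_le) (auto intro: order_trans[OF degree_smult_le] order_trans[OF degree_pCons_le])
  moreover have "Polynomial.degree (dir (Suc k)) \<le> Suc k"
    unfolding dir_Suc using Suc calculation
    by (intro degree_add_le) (auto intro: order_trans[OF degree_smult_le])
  ultimately show ?case ..
qed simp

lemmas degree_res = degree_res_dir[THEN conjunct1] and degree_dir = degree_res_dir[THEN conjunct2]

end

section \<open>Orthogonality and minimality for positive weights at distinct positive nodes\<close>

locale cg_measure = cg_recursion +
  assumes x_pos: "i \<in> {1..D} \<Longrightarrow> 0 < x i"
    and w_pos: "i \<in> {1..D} \<Longrightarrow> 0 < w i"
    and x_inj: "inj_on x {1..D}"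
begin

lemma poly_zero_on_nodes:
  assumes "Polynomial.degree h < D" "\<And>i. i \<in> {1..D} \<Longrightarrow> poly h (x i) = 0"
  shows "h = 0"
proof (rule ccontr)
  assume h: "h \<noteq> 0"
  have "D = card (x ` {1..D})" using x_inj by (simp add: card_image)
  also have "\<dots> \<le> card {z. poly h z = 0}"
    using assms(2) h by (intro card_mono poly_roots_finite) auto
  also have "\<dots> \<le> Polynomial.degree h" using card_poly_roots_bound[OF h] .
  finally show False using assms(1) by simp
qed

lemma weighted_square_pos:
  assumes "h \<noteq> 0" "Polynomial.degree h < D" "\<And>i. i \<in> {1..D} \<Longrightarrow> 0 < c i"
  shows "0 < (\<Sum>i=1..D. c i * (poly h (x i))\<^sup>2)"
proof -
  obtain i where i: "i \<in> {1..D}" "poly h (x i) \<noteq> 0"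
    using poly_zero_on_nodes[OF assms(2)] assms(1) by blast
  then show ?thesis
    using assms(3) by (intro sum_pos2[of _ i]) (auto simp: less_imp_le)
qed

lemma ip_self_pos: "h \<noteq> 0 \<Longrightarrow> Polynomial.degree h < D \<Longrightarrow> 0 < ip h h"
  using weighted_square_pos[of h "\<lambda>i. x i * w i"] x_pos w_pos
  by (simp add: ip_def power2_eq_square mult_ac)

lemma ip_self_nonneg: "0 \<le> ip h h"
  unfolding ip_def using x_pos w_pos
  by (intro sum_nonneg) (simp add: mult.assoc less_imp_le)

lemma ip_shift_self_pos: "h \<noteq> 0 \<Longrightarrow> Polynomial.degree h < D \<Longrightarrow> 0 < ip (pCons 0 h) h"
  using weighted_square_pos[of h "\<lambda>i. x i * x i * w i"] x_pos w_pos
  by (simp add: ip_def power2_eq_square mult_ac)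

lemma res_nonzero: "res k \<noteq> 0"
  using poly_res_0[of k] by force

lemma coupling_nonneg: "0 \<le> coupling k"
  by (simp add: coupling_def ip_self_nonneg)

lemma poly_dir_0: "1 \<le> poly (dir k) 0"
  by (induction k) (simp_all add: dir_Suc coupling_nonneg mult_nonneg_nonneg order_trans[OF zero_le_one])

lemma dir_nonzero: "dir k \<noteq> 0"
  using poly_dir_0[of k] by force

lemma step_pos: "k < D \<Longrightarrow> 0 < step k"
  unfolding step_def
  by (intro divide_pos_pos ip_self_pos ip_shift_self_pos res_nonzero dir_nonzero)
     (meson degree_res degree_dir order_le_less_trans)+

text \<open>The usual simultaneous induction. The step size makes the new residual orthogonal to the
  current direction, the coupling makes the new direction conjugate to it for multiplication by
  \<open>x\<close>, and older directions are handled by the induction hypotheses.\<close>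

lemma cg_orthogonality:
  "k \<le> D \<Longrightarrow> (\<forall>j<k. ip (dir j) (res k) = 0) \<and> (\<forall>j<k. ip (pCons 0 (dir j)) (dir k) = 0)"
proof (induction k)
  case (Suc k)
  then have k: "k < D" and IH1: "\<And>j. j < k \<Longrightarrow> ip (dir j) (res k) = 0"
    and IH2: "\<And>j. j < k \<Longrightarrow> ip (pCons 0 (dir j)) (dir k) = 0" by auto
  \<comment> \<open>\<open>dir k - res k\<close> is a multiple of the previous direction, to which
    \<open>res k\<close> is orthogonal.\<close>
  have rr: "ip (dir k) (res k) = ip (res k) (res k)"
  proof (cases k)
    case (Suc j)
    then show ?thesis using IH1[of j] by (simp add: dir_Suc ip_add_left ip_smult_left)
  qed simp
  have pp: "0 < ip (pCons 0 (dir k)) (dir k)"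
    using k degree_dir[of k] by (intro ip_shift_self_pos dir_nonzero) auto
  have step: "step k * ip (pCons 0 (dir k)) (dir k) = ip (res k) (res k)"
    using pp by (simp add: step_def)
  have H1: "ip (dir j) (res (Suc k)) = 0" if "j < Suc k" for j
  proof (cases "j = k")
    case True
    then show ?thesis using rr step by (simp add: res_Suc ip_linear ip_shift[symmetric])
  next
    case False
    then show ?thesis using that IH1 IH2 by (simp add: res_Suc ip_linear ip_shift[symmetric])
  qed
  have H1': "ip (res j) (res (Suc k)) = 0" if "j < Suc k" for j
  proof (cases j)
    case 0
    then show ?thesis using H1[of 0] by simp
  next
    case (Suc i)
    have "res j = dir j - Polynomial.smult (coupling i) (dir i)"
      using dir_Suc[of i] Suc by simp
    then show ?thesis using H1[of i] H1[of j] that Suc by (simp add: ip_linear)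
  qed
  \<comment> \<open>A shifted direction is a multiple of a difference of consecutive residuals, so
    conjugacy reduces to orthogonality of residuals.\<close>
  have X: "pCons 0 (dir j) = Polynomial.smult (1 / step j) (res j - res (Suc j))" if "j < D" for j
    using step_pos[OF that] by (simp add: res_Suc)
  have H2: "ip (pCons 0 (dir j)) (dir (Suc k)) = 0" if j: "j < Suc k" for j
  proof (cases "j = k")
    case True
    have rk: "0 < ip (res k) (res k)"
      using k degree_res[of k] by (intro ip_self_pos res_nonzero) auto
    have "ip (pCons 0 (dir k)) (res (Suc k)) = - ip (res (Suc k)) (res (Suc k)) / step k"
      using H1'[of k] by (subst X[OF k]) (simp add: ip_linear)
    also have "\<dots> = - coupling k * ip (pCons 0 (dir k)) (dir k)"
      using rk pp by (simp add: step_def coupling_def)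
    finally show ?thesis using True by (simp only: dir_Suc ip_linear)
  next
    case False
    have "j < D" "Suc j < Suc k" using j k False by auto
    have "ip (pCons 0 (dir j)) (res (Suc k)) = (ip (res j) (res (Suc k)) - ip (res (Suc j)) (res (Suc k))) / step j"
      using X[OF \<open>j < D\<close>] by (simp only: ip_linear) simp
    then show ?thesis using H1'[of j] H1'[of "Suc j"] \<open>Suc j < Suc k\<close> j IH2[of j]
      by (simp only: dir_Suc ip_linear) simp
  qed
  show ?case using H1 H2 by (intro conjI allI impI)
qed simp

lemma coeff_res_dir:
  "k \<le> D \<Longrightarrow> Polynomial.coeff (res k) k = Polynomial.coeff (dir k) k \<and> Polynomial.coeff (dir k) k \<noteq> 0"
proof (induction k)
  case (Suc k)
  have "Polynomial.coeff (res k) (Suc k) = 0" "Polynomial.coeff (dir k) (Suc k) = 0"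
    using degree_res[of k] degree_dir[of k] by (auto intro: coeff_eq_0)
  then show ?case using Suc step_pos[of k] by (simp add: res_Suc dir_Suc)
qed simp

text \<open>By \<open>coeff_res_dir\<close> each \<open>dir n\<close> with \<open>n < k\<close> has
  exact degree \<open>n\<close>, so these directions span the polynomials of degree below
  \<open>k\<close>; the induction removes one leading coefficient at a time.\<close>

lemma res_orthogonal:
  assumes "k \<le> D" "Polynomial.degree q < k"
  shows "ip q (res k) = 0"
proof -
  have "n \<le> k \<Longrightarrow> Polynomial.degree q < n \<Longrightarrow> ip q (res k) = 0" for n q
  proof (induction n arbitrary: q)
    case (Suc n)
    define c where "c = Polynomial.coeff q n / Polynomial.coeff (dir n) n"
    define q' where "q' = q - Polynomial.smult c (dir n)"
    have q: "q = q' + Polynomial.smult c (dir n)" by (simp add: q'_def)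
    have dn: "Polynomial.coeff (dir n) n \<noteq> 0" using coeff_res_dir[of n] Suc assms by simp
    have deg: "Polynomial.degree q' \<le> n"
      unfolding q'_def using Suc.prems degree_dir[of n]
      by (intro degree_diff_le) (auto intro: order_trans[OF degree_smult_le])
    have c0: "Polynomial.coeff q' n = 0" using dn by (simp add: q'_def c_def)
    have "ip q' (res k) = 0"
    proof (cases "q' = 0")
      case False
      then have "Polynomial.degree q' < n"
        using deg c0 by (metis le_neq_implies_less leading_coeff_0_iff)
      then show ?thesis using Suc by simp
    qed simp
    moreover have "ip (dir n) (res k) = 0"
      using cg_orthogonality[of k] assms Suc.prems by auto
    ultimately show ?case by (subst q) (simp add: ip_linear)
  qed simp
  from this[of k q] assms show ?thesis by simp
qed

lemma split_at_0:
  fixes q :: "real poly"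
  assumes "poly q 0 = c" "Polynomial.degree q \<le> k"
  obtains h where "q = [:c:] + pCons 0 h" "h = 0 \<or> Polynomial.degree h < k"
proof -
  obtain a h where q: "q = pCons a h" by (cases q)
  have "q = [:c:] + pCons 0 h" using assms q by simp
  moreover have "h = 0 \<or> Polynomial.degree h < k"
    using assms(2) q by (cases "h = 0") simp_all
  ultimately show ?thesis using that by blast
qed

text \<open>Without the factor \<open>x\<close> in the weights a residual sees \<open>q\<close> only
  through \<open>q(0)\<close>, because \<open>q - q(0)\<close> is \<open>x\<close> times a
  polynomial of degree below \<open>k\<close>.\<close>

lemma weighted_res:
  assumes "k \<le> D" "Polynomial.degree q \<le> k"
  shows "(\<Sum>i=1..D. w i * poly (res k) (x i) * poly q (x i))
       = poly q 0 * (\<Sum>i=1..D. w i * poly (res k) (x i))"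
proof -
  obtain h where q: "q = [:poly q 0:] + pCons 0 h" and h: "h = 0 \<or> Polynomial.degree h < k"
    using split_at_0[OF refl assms(2)] by metis
  have 0: "ip h (res k) = 0" using h res_orthogonal[OF assms(1)] by auto
  have "poly q (x i) = poly q 0 + x i * poly h (x i)" for i by (subst q) simp
  then have "(\<Sum>i=1..D. w i * poly (res k) (x i) * poly q (x i))
    = (\<Sum>i=1..D. poly q 0 * (w i * poly (res k) (x i)) + x i * w i * poly h (x i) * poly (res k) (x i))"
    by (intro sum.cong) (simp_all add: algebra_simps)
  also have "\<dots> = poly q 0 * (\<Sum>i=1..D. w i * poly (res k) (x i)) + ip h (res k)"
    by (simp add: sum.distrib sum_distrib_left ip_def)
  finally show ?thesis using 0 by simp
qed

lemma energy_res: "k \<le> D \<Longrightarrow> energy (res k) = (\<Sum>i=1..D. w i * poly (res k) (x i))"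
  using weighted_res[of k "res k"] degree_res[of k]
  by (simp add: energy_def power2_eq_square mult_ac)

text \<open>A feasible \<open>q\<close> differs from \<open>res k\<close> by a polynomial vanishing
  at 0, and by \<open>weighted_res\<close> such a polynomial is orthogonal to \<open>res k\<close>
  for the weights \<open>w\<close>.\<close>

lemma energy_pythagoras:
  assumes "k \<le> D" "cg_feasible k q"
  shows "energy q = energy (res k) + energy (q - res k)"
proof -
  have d: "Polynomial.degree (q - res k) \<le> k"
    using assms degree_res[of k] by (intro degree_diff_le) (auto simp: cg_feasible_def)
  have 0: "(\<Sum>i=1..D. w i * poly (res k) (x i) * poly (q - res k) (x i)) = 0"
    using weighted_res[OF assms(1) d] assms(2) by (simp add: cg_feasible_def)
  have "energy q = (\<Sum>i=1..D. w i * (poly (res k) (x i))\<^sup>2 + w i * (poly (q - res k) (x i))\<^sup>2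
      + 2 * (w i * poly (res k) (x i) * poly (q - res k) (x i)))"
    unfolding energy_def by (intro sum.cong) (auto simp: power2_eq_square algebra_simps)
  also have "\<dots> = energy (res k) + energy (q - res k)
      + 2 * (\<Sum>i=1..D. w i * poly (res k) (x i) * poly (q - res k) (x i))"
    unfolding energy_def by (simp only: sum.distrib sum_distrib_left)
  finally show ?thesis using 0 by simp
qed

lemma energy_nonneg: "0 \<le> energy q"
  unfolding energy_def using w_pos by (intro sum_nonneg) (simp add: less_imp_le)

lemma cg_feasible_res: "cg_feasible k (res k)"
  using degree_res[of k] by (simp add: cg_feasible_def)

text \<open>The difference has the form \<open>x h\<close> with \<open>h\<close> of degree below
  \<open>k\<close>, hence below \<open>D\<close>. Dividing out \<open>x\<close> is what covers
  \<open>k = D\<close>, where the difference itself may have degree \<open>D\<close>.\<close>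

lemma energy_zero_imp_eq:
  assumes "k \<le> D" "cg_feasible k q" "energy (q - res k) = 0"
  shows "q = res k"
proof -
  have d: "Polynomial.degree (q - res k) \<le> k"
    using assms degree_res[of k] by (intro degree_diff_le) (auto simp: cg_feasible_def)
  have "poly (q - res k) 0 = 0" using assms(2) by (simp add: cg_feasible_def)
  then obtain h where q: "q - res k = pCons 0 h" and h: "h = 0 \<or> Polynomial.degree h < k"
    using split_at_0[OF _ d] by (metis add.left_neutral pCons_0_0)
  have "energy (q - res k) = (\<Sum>i=1..D. w i * (x i)\<^sup>2 * (poly h (x i))\<^sup>2)"
    unfolding q energy_def by (simp add: power_mult_distrib mult_ac)
  then have "h = 0"
    using weighted_square_pos[of h "\<lambda>i. w i * (x i)\<^sup>2"] assms(1,3) h w_pos x_pos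
    by (metis dual_order.strict_trans1 less_irrefl mult_pos_pos zero_less_power)
  then show ?thesis using q by simp
qed

lemma res_unique_minimiser:
  assumes "k \<le> D"
  shows "(THE p. cg_feasible k p \<and> (\<forall>q. cg_feasible k q \<longrightarrow> energy p \<le> energy q)) = res k"
proof (rule the_equality)
  show "cg_feasible k (res k) \<and> (\<forall>q. cg_feasible k q \<longrightarrow> energy (res k) \<le> energy q)"
  proof (intro conjI allI impI)
    fix q assume "cg_feasible k q"
    from energy_pythagoras[OF assms this] energy_nonneg[of "q - res k"]
    show "energy (res k) \<le> energy q" by linarith
  qed (rule cg_feasible_res)
  fix p assume p: "cg_feasible k p \<and> (\<forall>q. cg_feasible k q \<longrightarrow> energy p \<le> energy q)"
  then have "energy (p - res k) \<le> 0"
    using energy_pythagoras[OF assms, of p] p p[THEN conjunct2, rule_format, OF cg_feasible_res]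
    by linarith
  then have "energy (p - res k) = 0"
    using energy_nonneg[of "p - res k"] by linarith
  then show "p = res k"
    using energy_zero_imp_eq[OF assms] p by blast
qed

lemma energy_res_antimono: "Suc k \<le> D \<Longrightarrow> energy (res (Suc k)) \<le> energy (res k)"
  using energy_pythagoras[of "Suc k" "res k"] energy_nonneg[of "res k - res (Suc k)"] degree_res[of k]
  by (simp add: cg_feasible_def)

text \<open>At degree \<open>D\<close> the product of the factors \<open>1 - x / x i\<close> is a
  competitor of energy zero.\<close>

lemma res_D_node:
  assumes "i \<in> {1..D}" shows "poly (res D) (x i) = 0"
proof -
  define q where "q = (\<Prod>i=1..D. [:1, - 1 / x i:])"
  have "Polynomial.degree q \<le> (\<Sum>i=1..D. Polynomial.degree [:1, - 1 / x i:])"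
    unfolding q_def using degree_prod_sum_le[of "{1..D}" "\<lambda>i. [:1, - 1 / x i:]"] by (simp only: o_def) simp
  also have "\<dots> \<le> (\<Sum>i=1..D. 1)" by (intro sum_mono) auto
  finally have "cg_feasible D q" by (simp add: cg_feasible_def q_def poly_prod)
  moreover have "energy q = 0"
  proof -
    have "poly q (x i) = 0" if "i \<in> {1..D}" for i
      unfolding q_def poly_prod using that x_pos[OF that] by (intro prod_zero) (auto intro!: bexI[of _ i])
    then show ?thesis by (simp add: energy_def)
  qed
  ultimately have "energy (res D) = 0"
    using energy_pythagoras[of D q] energy_nonneg[of "res D"] energy_nonneg[of "q - res D"] by simp
  then have "\<forall>i\<in>{1..D}. w i * (poly (res D) (x i))\<^sup>2 = 0"
    unfolding energy_def using w_pos by (subst (asm) sum_nonneg_eq_0_iff) (auto simp: less_imp_le)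
  then have "w i * (poly (res D) (x i))\<^sup>2 = 0" using assms by blast
  then show ?thesis using w_pos[OF assms] by simp
qed

end

section \<open>Residual polynomials truncated at their first zero\<close>

lemma first_zero:
  fixes p :: "real poly"
  assumes "0 < poly p 0" "poly p y \<le> 0" "0 \<le> y"
  obtains z where "0 < z" "z \<le> y" "poly p z = 0" "\<And>v. 0 \<le> v \<Longrightarrow> v < z \<Longrightarrow> 0 < poly p v"
proof -
  have root: "\<exists>v. 0 \<le> v \<and> v \<le> a \<and> poly p v = 0" if "poly p a \<le> 0" "0 \<le> a" for a
    using IVT2'[of "poly p" a 0 0] that assms(1) continuous_on_poly[OF continuous_on_id, of "{0..a}" p]
    by auto
  define Z where "Z = {v. poly p v = 0} \<inter> {0..y}"
  have "finite Z" "Z \<noteq> {}"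
    using root[OF assms(2,3)] assms(1) unfolding Z_def by (force intro!: finite_Int poly_roots_finite)+
  then have Min: "Min Z \<in> Z" by simp
  show ?thesis
  proof (rule that[of "Min Z"])
    show "0 < Min Z"
      using Min assms(1) by (metis Z_def Int_iff atLeastAtMost_iff less_irrefl mem_Collect_eq order_le_less)
    show "0 < poly p v" if v: "0 \<le> v" "v < Min Z" for v
    proof (rule ccontr)
      assume "\<not> 0 < poly p v"
      then obtain v' where v': "0 \<le> v'" "v' \<le> v" "poly p v' = 0" using root[of v] v by force
      moreover have "v \<le> y" using v Min by (auto simp: Z_def)
      ultimately have "v' \<in> Z" by (auto simp: Z_def)
      then show False using Min_le[OF \<open>finite Z\<close>, of v'] v v' by simp
    qed
  qed (use Min in \<open>auto simp: Z_def\<close>)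
qed

section \<open>Interpolated residuals and the region before their first zeros\<close>

context cg_recursion
begin

definition mix :: "nat \<Rightarrow> real \<Rightarrow> real poly" where
  "mix k \<alpha> = Polynomial.smult (1 - \<alpha>) (res k) + Polynomial.smult \<alpha> (res (Suc k))"

text \<open>All residuals up to \<open>k\<close> are tested, but only at \<open>z\<close>. By
  \<open>positive_to_iff\<close> this pointwise condition says that \<open>res k\<close> has no zero
  in \<open>[0, z]\<close>.\<close>

definition positive_to :: "nat \<Rightarrow> real set" where
  "positive_to k = {z. 0 \<le> z \<and> (\<forall>j\<le>k. 0 < poly (res j) z)}"

text \<open>
  The truncation \<open>r\<^bsub>t,<\<^esub>\<close> for \<open>t = k + \<alpha>\<close> (see \<open>cutoff_eq_least_zero\<close>), in a form whose continuity and
  measurability do not involve the position of the first zero.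
\<close>

definition cutoff :: "nat \<Rightarrow> real \<Rightarrow> real \<Rightarrow> real" where
  "cutoff k \<alpha> z = (if z \<in> positive_to k then max 0 (poly (mix k \<alpha>) z) else 0)"

lemma mix_0: "mix k 0 = res k" and mix_1: "mix k 1 = res (Suc k)"
  by (simp_all add: mix_def)

lemma poly_mix_0 [simp]: "poly (mix k \<alpha>) 0 = 1"
  by (simp add: mix_def)

lemma degree_mix: "Polynomial.degree (mix k \<alpha>) \<le> Suc k"
  unfolding mix_def
  by (intro degree_add_le order_trans[OF degree_smult_le] degree_res le_SucI[OF degree_res])

lemma positive_to_Suc: "z \<in> positive_to (Suc k) \<longleftrightarrow> z \<in> positive_to k \<and> 0 < poly (res (Suc k)) z"
  by (auto simp: positive_to_def le_Suc_eq)

lemma positive_to_0: "positive_to 0 = {0..}"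
  by (auto simp: positive_to_def)

lemma positive_toD: "z \<in> positive_to k \<Longrightarrow> 0 \<le> z" "z \<in> positive_to k \<Longrightarrow> 0 < poly (res k) z"
  by (auto simp: positive_to_def)

text \<open>
  Before the first zero the interpolant is \<open>r\<^sub>k(z) (1 - \<alpha> a\<^sub>k growth\<^sub>k(z))\<close> with the step size \<open>a\<^sub>k\<close>; monotonicity
  of \<open>growth\<close> is what makes the sets on which all interpolants are positive downward closed.
\<close>

definition growth :: "nat \<Rightarrow> real \<Rightarrow> real" where
  "growth k z = z * poly (dir k) z / poly (res k) z"

lemma poly_mix: "poly (mix k \<alpha>) z = poly (res k) z - \<alpha> * step k * (z * poly (dir k) z)"
  by (simp add: mix_def res_Suc algebra_simps)

lemma poly_mix_growth:
  assumes "z \<in> positive_to k"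
  shows "poly (mix k \<alpha>) z = poly (res k) z * (1 - \<alpha> * step k * growth k z)"
  using positive_toD(2)[OF assms] by (simp add: poly_mix growth_def field_simps)

end

context cg_measure
begin

lemma dir_pos: "z \<in> positive_to k \<Longrightarrow> 0 < poly (dir k) z"
proof (induction k)
  case (Suc k)
  then show ?case
    using coupling_nonneg[of k]
    by (auto simp: positive_to_Suc dir_Suc intro!: add_pos_nonneg mult_nonneg_nonneg)
qed simp

text \<open>Induction along \<open>growth (Suc k) z = z + coupling k * growth k z / (1 - step k *
  growth k z)\<close>. The right side increases with \<open>growth k z\<close> while the denominator
  is positive, that is, while \<open>res (Suc k)\<close> is.\<close>

lemma growth_mono:
  assumes "k \<le> D" "z' \<in> positive_to k" "0 \<le> z" "z \<le> z'"
  shows "z \<in> positive_to k \<and> 0 \<le> growth k z \<and> growth k z \<le> growth k z'"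
  using assms
proof (induction k)
  case 0
  then show ?case by (simp add: positive_to_0 growth_def)
next
  case (Suc k)
  then have z'k: "z' \<in> positive_to k" and IH: "z \<in> positive_to k" "0 \<le> growth k z" "growth k z \<le> growth k z'"
    by (auto simp: positive_to_Suc)
  have a: "0 < step k" using Suc.prems by (intro step_pos) simp
  have res': "poly (res (Suc k)) v = poly (res k) v * (1 - step k * growth k v)" if "v \<in> positive_to k" for v
    using poly_mix_growth[OF that, of 1] by (simp add: mix_1)
  have pos': "0 < 1 - step k * growth k z'"
    using Suc.prems(2) positive_toD(2)[OF z'k]
    by (simp add: positive_to_Suc res'[OF z'k] zero_less_mult_iff)
  moreover have "1 - step k * growth k z' \<le> 1 - step k * growth k z"
    using a IH by simp
  ultimately have pos: "0 < 1 - step k * growth k z" by linarith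
  have mem: "z \<in> positive_to (Suc k)"
    using pos positive_toD(2)[OF IH(1)] by (simp add: positive_to_Suc IH res')
  have growth': "growth (Suc k) v = v + coupling k * (growth k v / (1 - step k * growth k v))"
    if "v \<in> positive_to (Suc k)" for v
  proof -
    have v: "v \<in> positive_to k" and v': "0 < poly (res (Suc k)) v" using that by (auto simp: positive_to_Suc)
    have "growth (Suc k) v = v + coupling k * (v * poly (dir k) v / poly (res (Suc k)) v)"
      using v' by (simp add: growth_def dir_Suc field_simps)
    also have "v * poly (dir k) v = poly (res k) v * growth k v"
      using positive_toD(2)[OF v] by (simp add: growth_def)
    finally show ?thesis using positive_toD(2)[OF v] by (simp add: res'[OF v])
  qed
  have "growth k z / (1 - step k * growth k z) \<le> growth k z' / (1 - step k * growth k z')"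
    using IH a pos' by (intro frac_le) auto
  then have "growth (Suc k) z \<le> growth (Suc k) z'"
    unfolding growth'[OF mem] growth'[OF Suc.prems(2)]
    using Suc.prems(4) coupling_nonneg by (intro add_mono mult_left_mono)
  moreover have "0 \<le> growth (Suc k) z"
    using Suc.prems(3) dir_pos[OF mem] positive_toD(2)[OF mem] by (simp add: growth_def)
  ultimately show ?case using mem by simp
qed

lemma positive_to_downward: "k \<le> D \<Longrightarrow> z' \<in> positive_to k \<Longrightarrow> 0 \<le> z \<Longrightarrow> z \<le> z' \<Longrightarrow> z \<in> positive_to k"
  using growth_mono by blast

lemma mix_pos_downward:
  assumes "k < D" "0 \<le> \<alpha>" "z' \<in> positive_to k" "0 < poly (mix k \<alpha>) z'" "0 \<le> z" "z \<le> z'"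
  shows "0 < poly (mix k \<alpha>) z"
proof -
  have g: "z \<in> positive_to k" "growth k z \<le> growth k z'"
    using growth_mono[of k z' z] assms by auto
  have "0 < 1 - \<alpha> * step k * growth k z'"
    using assms(4) positive_toD(2)[OF assms(3)] by (simp add: poly_mix_growth[OF assms(3)] zero_less_mult_iff)
  also have "\<dots> \<le> 1 - \<alpha> * step k * growth k z"
    using assms(2) step_pos[OF assms(1)] g by (simp add: mult_left_mono)
  finally show ?thesis using positive_toD(2)[OF g(1)] by (simp add: poly_mix_growth[OF g(1)])
qed

lemma mix_le:
  assumes "k < D" "\<alpha> \<le> \<beta>" "z \<in> positive_to k"
  shows "poly (mix k \<beta>) z \<le> poly (mix k \<alpha>) z"
  using assms step_pos[OF assms(1)] dir_pos[OF assms(3)] positive_toD(1)[OF assms(3)]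
  by (auto simp: poly_mix intro!: mult_right_mono)

lemma cutoff_antimono: "k < D \<Longrightarrow> \<alpha> \<le> \<beta> \<Longrightarrow> cutoff k \<beta> z \<le> cutoff k \<alpha> z"
  using mix_le[of k \<alpha> \<beta> z] by (auto simp: cutoff_def)

lemma cutoff_nonneg: "0 \<le> cutoff k \<alpha> z"
  by (simp add: cutoff_def)

lemma cutoff_Suc: "cutoff (Suc k) 0 z = cutoff k 1 z"
  by (auto simp: cutoff_def mix_0 mix_1 positive_to_Suc)

text \<open>Up to the first zero \<open>y\<close> of \<open>res k\<close> the interpolant lies below
  \<open>res k\<close>, so by continuity it is nonpositive at \<open>y\<close>; its positivity on
  \<open>[0, z]\<close> excludes \<open>y <= z\<close>. Assumption \<open>res\<close> is one
  direction of \<open>positive_to_iff\<close>, passed in explicitly because this lemma is the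
  induction step there.\<close>

lemma mix_pos_imp_positive_to:
  assumes "k < D" "0 \<le> \<alpha>" and res: "\<And>v. 0 \<le> v \<Longrightarrow> (\<And>u. 0 \<le> u \<Longrightarrow> u \<le> v \<Longrightarrow> 0 < poly (res k) u) \<Longrightarrow> v \<in> positive_to k"
    and pos: "\<And>v. 0 \<le> v \<Longrightarrow> v \<le> z \<Longrightarrow> 0 < poly (mix k \<alpha>) v" and "0 \<le> z"
  shows "z \<in> positive_to k"
proof (rule res[OF \<open>0 \<le> z\<close>], rule ccontr)
  fix u assume u: "0 \<le> u" "u \<le> z" "\<not> 0 < poly (res k) u"
  then obtain y where y: "0 < y" "y \<le> u" "poly (res k) y = 0" and below: "\<And>v. 0 \<le> v \<Longrightarrow> v < y \<Longrightarrow> 0 < poly (res k) v"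
    using first_zero[of "res k" u] by auto
  have "poly (mix k \<alpha>) v - poly (res k) v \<le> 0" if "v \<in> {0..<y}" for v
  proof -
    have "v \<in> positive_to k" using that by (intro res below) auto
    then show ?thesis using mix_le[of k 0 \<alpha> v] assms by (simp add: mix_0)
  qed
  moreover have "closure {0..<y} = {0..y}" using y(1) by simp
  moreover have "continuous_on {0..y} (\<lambda>v. poly (mix k \<alpha>) v - poly (res k) v)"
    by (intro continuous_intros)
  ultimately have "poly (mix k \<alpha>) y - poly (res k) y \<le> 0"
    using continuous_le_on_closure[of "{0..<y}" "\<lambda>v. poly (mix k \<alpha>) v - poly (res k) v" y 0] y(1)
    by auto
  then show False using pos[of y] y u by simp
qed

lemma positive_to_iff:
  assumes "k \<le> D" "0 \<le> z"
  shows "z \<in> positive_to k \<longleftrightarrow> (\<forall>v\<in>{0..z}. 0 < poly (res k) v)"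
proof
  assume "z \<in> positive_to k"
  then show "\<forall>v\<in>{0..z}. 0 < poly (res k) v"
    using positive_to_downward[OF assms(1)] positive_toD(2) by force
next
  show "\<forall>v\<in>{0..z}. 0 < poly (res k) v \<Longrightarrow> z \<in> positive_to k"
    using assms
  proof (induction k arbitrary: z)
    case (Suc k)
    have "z \<in> positive_to k"
      by (rule mix_pos_imp_positive_to[of k 1 z]) (use Suc in \<open>auto simp: mix_1\<close>)
    then show ?case using Suc.prems by (auto simp: positive_to_Suc)
  qed (simp add: positive_to_0)
qed

text \<open>The link between truncation at the first zero and the pointwise sign conditions used in
  \<open>cutoff\<close>.\<close>

lemma before_zero_iff:
  assumes "k < D" "0 \<le> \<alpha>" "0 < Z" "poly (mix k \<alpha>) Z = 0"
    and below: "\<And>v. 0 \<le> v \<Longrightarrow> v < Z \<Longrightarrow> 0 < poly (mix k \<alpha>) v" and "0 \<le> z"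
  shows "z < Z \<longleftrightarrow> z \<in> positive_to k \<and> 0 < poly (mix k \<alpha>) z"
proof
  assume "z < Z"
  then have "z \<in> positive_to k"
    using assms positive_to_iff[of k] by (intro mix_pos_imp_positive_to[of k \<alpha> z]) auto
  then show "z \<in> positive_to k \<and> 0 < poly (mix k \<alpha>) z" using below \<open>z < Z\<close> \<open>0 \<le> z\<close> by simp
next
  assume "z \<in> positive_to k \<and> 0 < poly (mix k \<alpha>) z"
  then show "z < Z"
    using mix_pos_downward[of k \<alpha> z Z] assms by force
qed

end

section \<open>Real-rootedness and bounds for the truncated residual polynomials\<close>

lemma map_poly_of_real_mult:
  "map_poly complex_of_real (p * q) = map_poly of_real p * map_poly of_real q"
proof (induction p)
  case (pCons a p)
  have "map_poly complex_of_real (Polynomial.smult a q + pCons 0 (p * q))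
      = Polynomial.smult (of_real a) (map_poly of_real q) + pCons 0 (map_poly of_real (p * q))"
    by (intro poly_eqI) (simp add: coeff_map_poly coeff_pCons split: nat.split)
  then show ?case using pCons by (simp add: map_poly_pCons)
qed simp

lemma map_poly_of_real_add:
  "map_poly complex_of_real (p + q) = map_poly of_real p + map_poly of_real q"
  by (intro poly_eqI) (simp add: coeff_map_poly)

lemma poly_map_poly_of_real: "poly (map_poly complex_of_real p) (of_real z) = of_real (poly p z)"
  by (induction p) (simp_all add: map_poly_pCons)

text \<open>The remainder modulo the quadratic is real and at most linear; vanishing at a nonreal
  point, it is zero.\<close>

lemma nonreal_root_quadratic_dvd:
  fixes p :: "real poly"
  assumes root: "poly (map_poly complex_of_real p) c = 0" and "Im c \<noteq> 0"
  shows "[:(cmod c)\<^sup>2, - 2 * Re c, 1:] dvd p"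
proof -
  define s where "s = [:(cmod c)\<^sup>2, - 2 * Re c, 1:]"
  define m where "m = p mod s"
  have sc: "poly (map_poly complex_of_real s) c = 0"
    unfolding s_def cmod_power2
    by (simp add: map_poly_pCons complex_eq_iff power2_eq_square algebra_simps)
  have "poly (map_poly complex_of_real (s * (p div s) + m)) c = 0"
    using root by (simp add: m_def)
  then have mc: "poly (map_poly complex_of_real m) c = 0"
    by (simp add: map_poly_of_real_add map_poly_of_real_mult sc)
  have "Polynomial.degree s = 2" "s \<noteq> 0" by (auto simp: s_def)
  then have "m = 0 \<or> Polynomial.degree m < 2"
    unfolding m_def using degree_mod_less[of s p] by auto
  then have "Polynomial.degree m \<le> 1" by auto
  then obtain a b where m: "m = [:a, b:]"
    by (metis One_nat_def degree_pCons_eq degree_0 le_0_eq not_less_eq_eq pCons_cases degree_eq_zeroE)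
  have "b = 0" "a = 0" using mc assms(2) by (auto simp: m map_poly_pCons complex_eq_iff)
  then show ?thesis unfolding s_def[symmetric] by (simp add: m m_def[symmetric] dvd_eq_mod_eq_0)
qed

section \<open>Polynomials with positive zeros, normalised to 1 at the origin\<close>

definition root_poly :: "real list \<Rightarrow> real poly" where
  "root_poly zs = prod_list (map (\<lambda>z. [:1, - 1 / z:]) zs)"

lemma root_poly_simps [simp]:
  "root_poly [] = 1" "root_poly (z # zs) = [:1, - 1 / z:] * root_poly zs"
  by (simp_all add: root_poly_def)

lemma poly_root_poly_0 [simp]: "poly (root_poly zs) 0 = 1"
  by (induction zs) simp_all

lemma real_rooted_factorisation:
  fixes p :: "real poly"
  assumes "poly p 0 = 1"
    and "\<And>c. poly (map_poly complex_of_real p) c = 0 \<Longrightarrow> Im c = 0 \<and> 0 < Re c"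
  shows "\<exists>zs. (\<forall>z\<in>set zs. 0 < z) \<and> p = root_poly zs"
  using assms
proof (induction "Polynomial.degree p" arbitrary: p)
  case 0
  then obtain a where "p = [:a:]" using degree_eq_zeroE[of p] by metis
  then have "p = 1" using 0 by (simp add: one_pCons)
  then show ?case by (intro exI[of _ "[]"]) simp
next
  case (Suc n)
  have "Polynomial.degree (map_poly complex_of_real p) = Suc n"
    using Suc.hyps by (subst degree_map_poly) auto
  then have "\<not> constant (poly (map_poly complex_of_real p))"
    by (simp add: constant_degree)
  then obtain c where c: "poly (map_poly complex_of_real p) c = 0"
    using fundamental_theorem_of_algebra by blast
  define z where "z = Re c"
  have z: "c = of_real z" "0 < z" using Suc.prems(2)[OF c] by (auto simp: z_def complex_eq_iff)
  then have "poly p z = 0" using c by (simp add: poly_map_poly_of_real)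
  then have "[:-z, 1:] dvd p" by (simp add: poly_eq_0_iff_dvd)
  then obtain q0 where q0: "p = [:-z, 1:] * q0" by (elim dvdE)
  define q where "q = Polynomial.smult (- z) q0"
  have p: "p = [:1, -1/z:] * q"
  proof -
    have "[:-z, 1:] = Polynomial.smult (-z) [:1, -1/z:]" using z by simp
    then show ?thesis unfolding q0 q_def by (metis mult_smult_left mult_smult_right)
  qed
  have "q \<noteq> 0" using p Suc.prems(1) by auto
  then have "Polynomial.degree p = Suc (Polynomial.degree q)"
    unfolding p using z by (subst degree_mult_eq) auto
  moreover have "poly q 0 = 1" using Suc.prems(1) p by simp
  moreover have "Im c = 0 \<and> 0 < Re c" if "poly (map_poly complex_of_real q) c = 0" for c
    using Suc.prems(2)[of c] that by (simp add: p map_poly_of_real_mult del: mult_pCons_left)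
  ultimately obtain zs where "\<forall>z\<in>set zs. 0 < z" "q = root_poly zs"
    using Suc.hyps by auto
  then show ?case using z p by (intro exI[of _ "z # zs"]) simp
qed

text \<open>Up to the smallest zero every factor lies in \<open>[0, 1]\<close>. The inequality
  \<open>1 - v <= exp (- v)\<close>, factor by factor, gives the exponential bound, and a
  Weierstrass product inequality gives the linear one.\<close>

lemma root_poly_bounds:
  assumes "\<forall>z\<in>set zs. 0 < z \<and> y \<le> z" "0 \<le> y"
  shows "0 \<le> poly (root_poly zs) y \<and> poly (root_poly zs) y \<le> exp (- (\<Sum>z\<leftarrow>zs. 1 / z) * y)
    \<and> 1 - (\<Sum>z\<leftarrow>zs. 1 / z) * y \<le> poly (root_poly zs) y \<and> poly (root_poly zs) y \<le> 1"
  using assms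
proof (induction zs)
  case (Cons z zs)
  let ?s = "\<Sum>z\<leftarrow>zs. 1 / z" and ?p = "poly (root_poly zs) y"
  have IH: "0 \<le> ?p" "?p \<le> exp (- ?s * y)" "1 - ?s * y \<le> ?p" "?p \<le> 1" using Cons by auto
  have z: "0 < z" "y / z \<le> 1" "0 \<le> y / z" using Cons.prems by (auto simp: divide_simps)
  have eq: "poly (root_poly (z # zs)) y = (1 - y / z) * ?p" by (simp add: algebra_simps)
  have "(1 - y / z) * ?p \<le> exp (- (y / z)) * exp (- ?s * y)"
    using z IH exp_minus_ge[of "y / z"] by (intro mult_mono) auto
  also have "\<dots> = exp (- (\<Sum>z\<leftarrow>z # zs. 1 / z) * y)"
    by (simp add: exp_add[symmetric] algebra_simps)
  finally have "poly (root_poly (z # zs)) y \<le> exp (- (\<Sum>z\<leftarrow>z # zs. 1 / z) * y)" using eq by simp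
  moreover have "(y / z) * ?p \<le> y / z" using z IH by (intro mult_left_le) auto
  then have "1 - (\<Sum>z\<leftarrow>z # zs. 1 / z) * y \<le> (1 - y / z) * ?p" using IH by (simp add: algebra_simps)
  moreover have "0 \<le> (1 - y / z) * ?p" "(1 - y / z) * ?p \<le> 1"
    using z IH by (auto intro!: mult_nonneg_nonneg mult_le_one)
  ultimately show ?case using eq by simp
qed simp

lemma root_poly_pos: "\<forall>z\<in>set zs. 0 < z \<and> y < z \<Longrightarrow> 0 < poly (root_poly zs) y"
proof (induction zs)
  case (Cons z zs)
  then have "0 < (1 - y / z) * poly (root_poly zs) y" by (intro mult_pos_pos) auto
  then show ?case by (simp add: algebra_simps)
qed simp

lemma coeff_1_root_poly: "Polynomial.coeff (root_poly zs) 1 = - (\<Sum>z\<leftarrow>zs. 1 / z)"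
proof (induction zs)
  case (Cons z zs)
  have "Polynomial.coeff (root_poly zs) 0 = 1" using poly_root_poly_0[of zs] by (simp add: poly_0_coeff_0)
  then show ?case using Cons by (simp add: coeff_pCons split: nat.split)
qed simp

lemma root_poly_remove1: "z \<in> set zs \<Longrightarrow> root_poly zs = [:1, - 1 / z:] * root_poly (remove1 z zs)"
  by (induction zs) (auto simp: mult.left_commute simp del: mult_pCons_left)

lemma degree_root_poly: "0 \<notin> set zs \<Longrightarrow> Polynomial.degree (root_poly zs) = length zs"
proof (induction zs)
  case (Cons z zs)
  have "root_poly zs \<noteq> 0" using poly_root_poly_0[of zs] by force
  then show ?case using Cons by (simp add: degree_mult_eq del: mult_pCons_left)
qed simp

section \<open>Zeros of the interpolants and the resulting bounds on the truncation\<close>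

context cg_measure
begin

lemma mix_orthogonal:
  "k < D \<Longrightarrow> Polynomial.degree q < k \<Longrightarrow> ip q (mix k \<alpha>) = 0"
  by (simp add: mix_def ip_linear res_orthogonal)

text \<open>\<open>ip h p\<close> is a positively weighted sum of squares of \<open>h\<close>, so it
  cannot vanish. With a suitable factor \<open>s\<close> this excludes nonreal zeros of the
  interpolants and nonpositive zeros of the residuals.\<close>

lemma no_positive_factor:
  assumes "p = s * h" "p \<noteq> 0" "ip h p = 0" "Polynomial.degree h < D" "\<And>i. i \<in> {1..D} \<Longrightarrow> 0 < poly s (x i)"
  shows False
proof -
  have "ip h p = (\<Sum>i=1..D. (x i * w i * poly s (x i)) * (poly h (x i))\<^sup>2)"
    by (simp add: ip_def assms(1) power2_eq_square mult_ac)
  then show False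
    using weighted_square_pos[of h "\<lambda>i. x i * w i * poly s (x i)"] assms x_pos w_pos by auto
qed

lemma degree_cofactor:
  fixes s h :: "real poly"
  assumes "s * h \<noteq> 0" "Polynomial.degree (s * h) \<le> n"
  shows "Polynomial.degree s + Polynomial.degree h \<le> n"
  using assms by (metis degree_mult_eq mult_zero_left mult_zero_right)

text \<open>
  The cofactor of a real quadratic without real zeros has degree below \<open>k\<close>, so it is orthogonal to the
  interpolant although their product is nonnegative.
\<close>

lemma mix_roots_real:
  assumes "k < D" "poly (map_poly complex_of_real (mix k \<alpha>)) c = 0"
  shows "Im c = 0"
proof (rule ccontr)
  assume c: "Im c \<noteq> 0"
  let ?s = "[:(cmod c)\<^sup>2, - 2 * Re c, 1:]"
  obtain h where h: "mix k \<alpha> = ?s * h"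
    using nonreal_root_quadratic_dvd[OF assms(2) c] by (elim dvdE)
  have nz: "mix k \<alpha> \<noteq> 0" using poly_mix_0[of k \<alpha>] by force
  have "2 + Polynomial.degree h \<le> Suc k"
    using degree_cofactor[of ?s h "Suc k"] nz degree_mix[of k \<alpha>] h by simp
  moreover have "0 < poly ?s y" for y
  proof -
    have "poly ?s y = (y - Re c)\<^sup>2 + (Im c)\<^sup>2"
      using cmod_power2[of c] by (simp add: power2_eq_square algebra_simps)
    then show ?thesis using c by (simp add: sum_power2_gt_zero_iff)
  qed
  ultimately show False
    using no_positive_factor[OF h nz mix_orthogonal] assms(1) by auto
qed

text \<open>A nonpositive zero would split off a linear factor positive at the nodes. For a general
  interpolant the argument is one degree short, since the cofactor may have degree \<open>k\<close>;
  \<open>mix_pos_nonpositive\<close> therefore uses convex combinations.\<close>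

lemma res_pos_nonpositive:
  assumes "k \<le> D" "y \<le> 0"
  shows "0 < poly (res k) y"
proof (rule ccontr)
  assume "\<not> 0 < poly (res k) y"
  then obtain z where z: "z \<le> 0" "poly (res k) z = 0"
    using IVT'[of "poly (res k)" y 0 0] assms(2) continuous_on_poly[OF continuous_on_id, of "{y..0}" "res k"]
    by auto
  then have "[:-z, 1:] dvd res k" by (simp add: poly_eq_0_iff_dvd)
  then obtain h where h: "res k = [:-z, 1:] * h" by (elim dvdE)
  have "1 + Polynomial.degree h \<le> k"
    using degree_cofactor[of "[:-z, 1:]" h k] res_nonzero[of k] degree_res[of k] h by simp
  then show False
    using no_positive_factor[OF h res_nonzero res_orthogonal] assms(1) z x_pos by force
qed

lemma mix_pos_nonpositive:
  assumes "k < D" "0 \<le> \<alpha>" "\<alpha> \<le> 1" "y \<le> 0"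
  shows "0 < poly (mix k \<alpha>) y"
proof (cases "\<alpha> = 0")
  case True
  then show ?thesis using res_pos_nonpositive[of k y] assms by (simp add: mix_0)
next
  case False
  then show ?thesis
    using res_pos_nonpositive[of k y] res_pos_nonpositive[of "Suc k" y] assms
    by (auto simp: mix_def intro!: add_nonneg_pos mult_nonneg_nonneg)
qed

text \<open>Collects what the bounds below need: positive zeros with multiplicity, and
  \<open>cutoff\<close> as truncation at the smallest of them. The list may be empty, as at
  \<open>t = 0\<close>, where nothing is truncated.\<close>

lemma mix_factorisation:
  assumes "k < D" "0 \<le> \<alpha>" "\<alpha> \<le> 1"
  obtains zs where "\<forall>z\<in>set zs. 0 < z" "mix k \<alpha> = root_poly zs"
    "\<And>y. 0 \<le> y \<Longrightarrow> cutoff k \<alpha> y = (if \<forall>z\<in>set zs. y < z then poly (mix k \<alpha>) y else 0)"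
proof -
  have "\<exists>zs. (\<forall>z\<in>set zs. 0 < z) \<and> mix k \<alpha> = root_poly zs"
  proof (rule real_rooted_factorisation)
    fix c assume c: "poly (map_poly complex_of_real (mix k \<alpha>)) c = 0"
    have "Im c = 0" using mix_roots_real[OF assms(1) c] .
    then have "c = of_real (Re c)" by (simp add: complex_eq_iff)
    then have "poly (mix k \<alpha>) (Re c) = 0" using c poly_map_poly_of_real by (metis of_real_eq_0_iff)
    then show "Im c = 0 \<and> 0 < Re c"
      using mix_pos_nonpositive[OF assms, of "Re c"] \<open>Im c = 0\<close> by force
  qed simp
  then obtain zs where zs: "\<forall>z\<in>set zs. 0 < z" and mix: "mix k \<alpha> = root_poly zs" by blast
  have pos: "0 < poly (mix k \<alpha>) v" if "0 \<le> v" "\<forall>z\<in>set zs. v < z" for v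
    unfolding mix using that zs by (intro root_poly_pos) auto
  have "cutoff k \<alpha> y = (if \<forall>z\<in>set zs. y < z then poly (mix k \<alpha>) y else 0)" if y: "0 \<le> y" for y
  proof (cases "zs = []")
    case True
    have "y \<in> positive_to k"
      using True positive_to_iff[of k] assms y by (intro mix_pos_imp_positive_to[of k \<alpha> y] pos) auto
    then show ?thesis using True pos[of y] y by (simp add: cutoff_def)
  next
    case False
    define Z where "Z = Min (set zs)"
    have Z: "Z \<in> set zs" "\<And>z. z \<in> set zs \<Longrightarrow> Z \<le> z" using False by (auto simp: Z_def)
    have "poly (mix k \<alpha>) Z = 0"
      unfolding mix root_poly_remove1[OF Z(1)] using Z(1) zs by auto
    then have "y < Z \<longleftrightarrow> y \<in> positive_to k \<and> 0 < poly (mix k \<alpha>) y"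
      using assms Z zs y by (intro before_zero_iff pos) force+
    moreover have "y < Z \<longleftrightarrow> (\<forall>z\<in>set zs. y < z)" using Z by force
    ultimately show ?thesis by (auto simp: cutoff_def)
  qed
  then show ?thesis using zs mix that by blast
qed

text \<open>This is minus the derivative at 0, that is, the sum of the reciprocals of the zeros. It
  takes the role of the Showalter time.\<close>

definition slope :: "nat \<Rightarrow> real \<Rightarrow> real" where
  "slope k \<alpha> = - Polynomial.coeff (mix k \<alpha>) 1"

lemma slope_mix: "slope k \<alpha> = (1 - \<alpha>) * slope k 0 + \<alpha> * slope k 1"
  by (simp add: slope_def mix_def)

lemma slope_Suc: "slope (Suc k) 0 = slope k 1"
  by (simp add: slope_def mix_def)

lemma slope_0: "slope 0 0 = 0"
  by (simp add: slope_def mix_def)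

lemma cutoff_bounds:
  assumes "k < D" "0 \<le> \<alpha>" "\<alpha> \<le> 1" "0 \<le> y"
  shows "cutoff k \<alpha> y \<le> exp (- slope k \<alpha> * y)" "1 - cutoff k \<alpha> y \<le> slope k \<alpha> * y" "cutoff k \<alpha> y \<le> 1"
proof -
  obtain zs where zs: "\<forall>z\<in>set zs. 0 < z" and mix: "mix k \<alpha> = root_poly zs"
    and cutoff: "\<And>y. 0 \<le> y \<Longrightarrow> cutoff k \<alpha> y = (if \<forall>z\<in>set zs. y < z then poly (mix k \<alpha>) y else 0)"
    using mix_factorisation[OF assms(1-3)] by blast
  have s: "slope k \<alpha> = (\<Sum>z\<leftarrow>zs. 1 / z)" using coeff_1_root_poly[of zs] by (simp add: slope_def mix)
  have "cutoff k \<alpha> y \<le> exp (- slope k \<alpha> * y) \<and> 1 - cutoff k \<alpha> y \<le> slope k \<alpha> * y \<and> cutoff k \<alpha> y \<le> 1"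
  proof (cases "\<forall>z\<in>set zs. y < z")
    case True
    then show ?thesis using root_poly_bounds[of zs y] zs assms(4) by (force simp: cutoff mix s less_imp_le)
  next
    case False
    then obtain z where z: "z \<in> set zs" "z \<le> y" by force
    \<comment> \<open>Past a zero \<open>z\<close> the summand \<open>1 / z\<close> alone gives
      \<open>slope k \<alpha> * y >= 1\<close>, so the linear bound survives the truncation to
      0.\<close>
    have "1 / z \<le> (\<Sum>z\<leftarrow>zs. 1 / z)"
      using z zs by (intro member_le_sum_list) (auto simp: less_imp_le)
    then have "1 / z * y \<le> slope k \<alpha> * y" unfolding s using assms(4) by (intro mult_right_mono)
    moreover have "1 \<le> 1 / z * y" using z zs by (simp add: divide_simps)
    moreover have "cutoff k \<alpha> y = 0" using cutoff[OF assms(4)] unfolding if_not_P[OF False] .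
    ultimately show ?thesis by simp
  qed
  then show "cutoff k \<alpha> y \<le> exp (- slope k \<alpha> * y)" "1 - cutoff k \<alpha> y \<le> slope k \<alpha> * y" "cutoff k \<alpha> y \<le> 1"
    by blast+
qed

text \<open>For the residuals themselves this is the equality \<open>energy_res\<close>. Between
  them the quadratic energy falls below linear interpolation by
  \<open>\<alpha> (1 - \<alpha>)\<close> times the energy drop, which is nonnegative.\<close>

lemma energy_mix_le_sum:
  assumes "k < D" "0 \<le> \<alpha>" "\<alpha> \<le> 1"
  shows "energy (mix k \<alpha>) \<le> (\<Sum>i=1..D. w i * poly (mix k \<alpha>) (x i))"
proof -
  let ?r = "poly (res k)" and ?r' = "poly (res (Suc k))"
  have e: "energy (res k) = (\<Sum>i=1..D. w i * ?r (x i))" "energy (res (Suc k)) = (\<Sum>i=1..D. w i * ?r' (x i))"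
    using assms energy_res[of k] energy_res[of "Suc k"] by simp_all
  have cross: "(\<Sum>i=1..D. w i * ?r' (x i) * ?r (x i)) = energy (res (Suc k))"
    using weighted_res[of "Suc k" "res k"] degree_res[of k] assms by (simp add: e)
  have "energy (mix k \<alpha>) = (\<Sum>i=1..D. (1 - \<alpha>)\<^sup>2 * (w i * (?r (x i))\<^sup>2) + \<alpha>\<^sup>2 * (w i * (?r' (x i))\<^sup>2)
      + 2 * \<alpha> * (1 - \<alpha>) * (w i * ?r' (x i) * ?r (x i)))"
    unfolding energy_def mix_def by (intro sum.cong) (simp_all add: power2_eq_square algebra_simps)
  also have "\<dots> = (1 - \<alpha>)\<^sup>2 * energy (res k) + \<alpha>\<^sup>2 * energy (res (Suc k)) + 2 * \<alpha> * (1 - \<alpha>) * energy (res (Suc k))"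
    by (simp only: sum.distrib sum_distrib_left[symmetric] energy_def[symmetric] cross)
  also have "\<dots> = (1 - \<alpha>) * energy (res k) + \<alpha> * energy (res (Suc k))
      - \<alpha> * (1 - \<alpha>) * (energy (res k) - energy (res (Suc k)))"
    by (simp add: power2_eq_square algebra_simps)
  also have "\<dots> \<le> (1 - \<alpha>) * energy (res k) + \<alpha> * energy (res (Suc k))"
    using energy_res_antimono[of k] assms by simp
  also have "\<dots> = (\<Sum>i=1..D. w i * poly (mix k \<alpha>) (x i))"
    by (simp add: e mix_def sum_distrib_left sum.distrib[symmetric] algebra_simps)
  finally show ?thesis .
qed

lemma weighted_mix:
  assumes "k < D" "Polynomial.degree q \<le> k"
  shows "(\<Sum>i=1..D. w i * poly (mix k \<alpha>) (x i) * poly q (x i))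
       = poly q 0 * (\<Sum>i=1..D. w i * poly (mix k \<alpha>) (x i))"
proof -
  have "(\<Sum>i=1..D. w i * poly (mix k \<alpha>) (x i) * poly q (x i))
      = (1 - \<alpha>) * (\<Sum>i=1..D. w i * poly (res k) (x i) * poly q (x i))
      + \<alpha> * (\<Sum>i=1..D. w i * poly (res (Suc k)) (x i) * poly q (x i))"
    by (simp add: mix_def sum_distrib_left sum.distrib[symmetric] algebra_simps)
  also have "\<dots> = (1 - \<alpha>) * (poly q 0 * (\<Sum>i=1..D. w i * poly (res k) (x i)))
      + \<alpha> * (poly q 0 * (\<Sum>i=1..D. w i * poly (res (Suc k)) (x i)))"
    using assms by (subst (1 2) weighted_res) auto
  also have "\<dots> = poly q 0 * (\<Sum>i=1..D. w i * poly (mix k \<alpha>) (x i))"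
    by (simp add: mix_def sum_distrib_left sum.distrib[symmetric] algebra_simps)
  finally show ?thesis .
qed

text \<open>Makes the last two terms of the approximation error nonpositive together, as used in
  \<open>approx_le\<close>.\<close>

lemma energy_mix_le_cutoff:
  assumes "k < D" "0 \<le> \<alpha>" "\<alpha> \<le> 1"
  shows "energy (mix k \<alpha>) \<le> (\<Sum>i=1..D. w i * cutoff k \<alpha> (x i))"
proof -
  obtain zs where zs: "\<forall>z\<in>set zs. 0 < z" and mix: "mix k \<alpha> = root_poly zs"
    and cutoff: "\<And>y. 0 \<le> y \<Longrightarrow> cutoff k \<alpha> y = (if \<forall>z\<in>set zs. y < z then poly (mix k \<alpha>) y else 0)"
    using mix_factorisation[OF assms] by blast
  note x0 = x_pos[THEN less_imp_le]
  show ?thesis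
  proof (cases "zs = []")
    case True
    then show ?thesis
      using energy_mix_le_sum[OF assms] by (simp add: cutoff x0)
  next
    case False
    define Z where "Z = Min (set zs)"
    have Z: "Z \<in> set zs" "\<And>z. z \<in> set zs \<Longrightarrow> Z \<le> z" using False by (auto simp: Z_def)
    \<comment> \<open>\<open>\<phi> = r\<^sub>t / (1 - x / Z)\<close> satisfies \<open>\<phi>(0) = 1\<close>, so orthogonality allows to multiply \<open>r\<^sub>t\<close> by it;
      \<open>r\<^sub>t \<phi> = (1 - x / Z) \<phi>\<^sup>2\<close> is nonpositive from \<open>Z\<close> on, and \<open>\<phi> \<le> 1\<close> before.\<close>
    define \<phi> where "\<phi> = root_poly (remove1 Z zs)"
    have fac: "mix k \<alpha> = [:1, - 1 / Z:] * \<phi>" by (simp add: mix \<phi>_def root_poly_remove1[OF Z(1)] del: mult_pCons_left)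
    have "length zs \<le> Suc k"
      using degree_mix[of k \<alpha>] zs degree_root_poly[of zs] by (force simp: mix)
    then have deg: "Polynomial.degree \<phi> \<le> k"
      using zs Z(1) degree_root_poly[of "remove1 Z zs"] set_remove1_subset[of Z zs]
      by (force simp: \<phi>_def length_remove1)
    have "energy (mix k \<alpha>) \<le> (\<Sum>i=1..D. w i * poly (mix k \<alpha>) (x i) * poly \<phi> (x i))"
      using energy_mix_le_sum[OF assms] weighted_mix[OF assms(1) deg] by (simp add: \<phi>_def)
    also have "\<dots> \<le> (\<Sum>i=1..D. w i * cutoff k \<alpha> (x i))"
    proof (intro sum_mono)
      fix i assume i: "i \<in> {1..D}"
      have "poly (mix k \<alpha>) (x i) * poly \<phi> (x i) \<le> cutoff k \<alpha> (x i)"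
      proof (cases "x i < Z")
        case True
        then have lt: "\<forall>z\<in>set zs. x i < z" using Z by force
        then have "poly \<phi> (x i) \<le> 1"
          unfolding \<phi>_def using x0[OF i] zs set_remove1_subset[of Z zs]
          by (intro root_poly_bounds[THEN conjunct2, THEN conjunct2, THEN conjunct2]) (auto simp: less_imp_le)
        moreover have "0 \<le> poly (mix k \<alpha>) (x i)"
          unfolding mix using lt zs by (intro less_imp_le root_poly_pos) auto
        ultimately show ?thesis using lt x0[OF i] by (auto simp: cutoff intro: mult_left_le)
      next
        case False
        then have "(1 - x i / Z) * (poly \<phi> (x i))\<^sup>2 \<le> 0"
          using zs Z(1) by (intro mult_nonpos_nonneg) (auto simp: divide_simps)
        then have "poly (mix k \<alpha>) (x i) * poly \<phi> (x i) \<le> 0"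
          by (simp add: fac power2_eq_square algebra_simps)
        then show ?thesis using cutoff_nonneg[of k \<alpha> "x i"] by linarith
      qed
      then show "w i * poly (mix k \<alpha>) (x i) * poly \<phi> (x i) \<le> w i * cutoff k \<alpha> (x i)"
        using w_pos[OF i] by (simp add: mult.assoc)
    qed
    finally show ?thesis .
  qed
qed

text \<open>Forces the interpolant to have a zero once \<open>\<alpha> > 0\<close>, so that the
  least zero in \<open>cutoff_eq_least_zero\<close> exists.\<close>

lemma slope_pos:
  assumes "k < D" "0 < \<alpha>" "\<alpha> \<le> 1"
  shows "0 < slope k \<alpha>"
proof -
  have nonneg: "0 \<le> slope k \<beta>" if "0 \<le> \<beta>" "\<beta> \<le> 1" for \<beta>
    using cutoff_bounds(2,3)[OF assms(1) that, of 1] by simp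
  have "Polynomial.coeff (dir k) 0 = poly (dir k) 0" by (simp add: poly_0_coeff_0)
  then have "slope k \<alpha> = slope k 0 + \<alpha> * step k * poly (dir k) 0"
    by (simp add: slope_def mix_def res_Suc algebra_simps)
  moreover have "0 < \<alpha> * step k * poly (dir k) 0"
    using assms step_pos[of k] poly_dir_0[of k] by (intro mult_pos_pos) auto
  ultimately show ?thesis using nonneg[of 0] by simp
qed

lemma cutoff_eq_least_zero:
  assumes "k < D" "0 < \<alpha>" "\<alpha> \<le> 1" "0 \<le> y"
  shows "cutoff k \<alpha> y = (if y < (LEAST z. 0 \<le> z \<and> poly (mix k \<alpha>) z = 0) then poly (mix k \<alpha>) y else 0)"
proof -
  obtain zs where zs: "\<forall>z\<in>set zs. 0 < z" and mix: "mix k \<alpha> = root_poly zs"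
    and cutoff: "\<And>y. 0 \<le> y \<Longrightarrow> cutoff k \<alpha> y = (if \<forall>z\<in>set zs. y < z then poly (mix k \<alpha>) y else 0)"
    using mix_factorisation[of k \<alpha>] assms by auto
  have "zs \<noteq> []" using slope_pos[OF assms(1-3)] mix by (auto simp: slope_def)
  define Z where "Z = Min (set zs)"
  have Z: "Z \<in> set zs" "\<And>z. z \<in> set zs \<Longrightarrow> Z \<le> z" using \<open>zs \<noteq> []\<close> by (auto simp: Z_def)
  have "(LEAST z. 0 \<le> z \<and> poly (mix k \<alpha>) z = 0) = Z"
  proof (rule Least_equality)
    show "0 \<le> Z \<and> poly (mix k \<alpha>) Z = 0"
      unfolding mix root_poly_remove1[OF Z(1)] using Z(1) zs by (auto simp: less_imp_le)
    fix z assume z: "0 \<le> z \<and> poly (mix k \<alpha>) z = 0"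
    show "Z \<le> z"
    proof (rule ccontr)
      assume "\<not> Z \<le> z"
      then have "0 < poly (mix k \<alpha>) z" unfolding mix using Z zs by (intro root_poly_pos) force
      then show False using z by simp
    qed
  qed
  moreover have "y < Z \<longleftrightarrow> (\<forall>z\<in>set zs. y < z)" using Z by force
  ultimately show ?thesis using cutoff[OF assms(4)] by simp
qed

end

section \<open>The continuous iteration index and the balanced oracle\<close>

text \<open>\<open>t = k + \<alpha>\<close> with \<open>\<alpha> \<in> (0, 1]\<close> lies in segment \<open>k\<close>, and \<open>t = 0\<close> is put into segment \<open>0\<close> with \<open>\<alpha> = 0\<close>.\<close>

definition segment :: "real \<Rightarrow> nat" where "segment t = nat (\<lceil>t\<rceil> - 1)"

lemma segment_unique: "real k < t \<Longrightarrow> t \<le> real k + 1 \<Longrightarrow> segment t = k"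
  unfolding segment_def by linarith

lemma segment_bounds:
  assumes "0 \<le> t" "t \<le> real n" "0 < n"
  shows "segment t < n" "0 \<le> t - real (segment t)" "t - real (segment t) \<le> 1"
  using assms unfolding segment_def by linarith+

text \<open>At a positive integer \<open>t = k\<close> the convention picks segment
  \<open>k - 1\<close> with \<open>\<alpha> = 1\<close>. If the pieces match there, the formula of
  segment \<open>k\<close> holds on the whole closed interval, as the continuity and monotonicity
  arguments require.\<close>

lemma segment_glue:
  assumes "\<And>k. f k 1 = f (Suc k) 0" "real k \<le> t" "t \<le> real k + 1"
  shows "f (segment t) (t - real (segment t)) = f k (t - real k)"
proof (cases "t = real k")
  case True
  show ?thesis
  proof (cases k)
    case 0
    then show ?thesis using True by (simp add: segment_def)
  next
    case (Suc j)
    then have "segment t = j" using True by (intro segment_unique) auto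
    then show ?thesis using True Suc assms(1) by simp
  qed
next
  case False
  then show ?thesis using segment_unique[of k t] assms by simp
qed

lemma continuous_on_unit_intervals:
  assumes "\<And>k. k < n \<Longrightarrow> continuous_on {real k..real k + 1} F"
  shows "continuous_on {0..real n} F"
  using assms
proof (induction n)
  case (Suc n)
  have "continuous_on ({0..real n} \<union> {real n..real n + 1}) F"
    using Suc by (intro continuous_on_closed_Un) auto
  moreover have "{0..real (Suc n)} = {0..real n} \<union> {real n..real n + 1}" by auto
  ultimately show ?case by simp
qed simp

lemma antimono_on_unit_intervals:
  fixes F :: "real \<Rightarrow> real"
  assumes "\<And>k s t. k < n \<Longrightarrow> real k \<le> s \<Longrightarrow> s \<le> t \<Longrightarrow> t \<le> real k + 1 \<Longrightarrow> F t \<le> F s"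
    and "0 \<le> s" "s \<le> t" "t \<le> real n"
  shows "F t \<le> F s"
  using assms
proof (induction n arbitrary: s t)
  case (Suc n)
  consider "t \<le> real n" | "real n \<le> s" | "s \<le> real n" "real n \<le> t" by linarith
  then show ?case
  proof cases
    case 1
    show ?thesis by (rule Suc.IH[OF Suc.prems(1) Suc.prems(2,3) 1]) simp_all
  next
    case 2
    show ?thesis by (rule Suc.prems(1)[of n]) (use 2 Suc.prems(3,4) in simp_all)
  next
    case 3
    have "F (real n) \<le> F s"
      by (rule Suc.IH[OF Suc.prems(1) Suc.prems(2) 3(1)]) simp_all
    moreover have "F t \<le> F (real n)"
      by (rule Suc.prems(1)[of n]) (use 3 Suc.prems(4) in simp_all)
    ultimately show ?thesis by simp
  qed
qed (metis dual_order.antisym dual_order.trans of_nat_0 order_refl)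

section \<open>Residuals and filters as functions of the continuous index\<close>

context cg_recursion
begin

definition res_at :: "real \<Rightarrow> real poly" where
  "res_at t = mix (segment t) (t - real (segment t))"

definition filter_at :: "real \<Rightarrow> real \<Rightarrow> real" where
  "filter_at t z = cutoff (segment t) (t - real (segment t)) z"

lemma res_at_segment: "real k \<le> t \<Longrightarrow> t \<le> real k + 1 \<Longrightarrow> res_at t = mix k (t - real k)"
  unfolding res_at_def by (rule segment_glue) (auto simp: mix_0 mix_1)

end

context cg_measure
begin

lemma filter_at_segment: "real k \<le> t \<Longrightarrow> t \<le> real k + 1 \<Longrightarrow> filter_at t z = cutoff k (t - real k) z"
  unfolding filter_at_def by (rule segment_glue[of "\<lambda>k \<alpha>. cutoff k \<alpha> z"]) (auto simp: cutoff_Suc)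

lemma continuous_on_poly_res_at: "continuous_on {0..real D} (\<lambda>t. poly (res_at t) z)"
proof (rule continuous_on_unit_intervals)
  fix k
  have "continuous_on {real k..real k + 1} (\<lambda>t. poly (mix k (t - real k)) z)"
    unfolding mix_def by (auto intro!: continuous_intros)
  then show "continuous_on {real k..real k + 1} (\<lambda>t. poly (res_at t) z)"
    by (rule continuous_on_eq) (simp add: res_at_segment[of k])
qed

lemma continuous_on_filter_at: "continuous_on {0..real D} (\<lambda>t. filter_at t z)"
proof (rule continuous_on_unit_intervals)
  fix k
  have "continuous_on {real k..real k + 1} (\<lambda>t. cutoff k (t - real k) z)"
    unfolding cutoff_def mix_def by (cases "z \<in> positive_to k") (auto intro!: continuous_intros)
  then show "continuous_on {real k..real k + 1} (\<lambda>t. filter_at t z)"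
    by (rule continuous_on_eq) (simp add: filter_at_segment[of k])
qed

lemma filter_at_antimono: "0 \<le> s \<Longrightarrow> s \<le> t \<Longrightarrow> t \<le> real D \<Longrightarrow> filter_at t z \<le> filter_at s z"
proof (rule antimono_on_unit_intervals[of D "\<lambda>t. filter_at t z"])
  fix k s t assume "k < D" "real k \<le> s" "s \<le> t" "t \<le> real k + 1"
  then show "filter_at t z \<le> filter_at s z"
    by (simp add: filter_at_segment[of k] cutoff_antimono)
qed

lemma filter_at_nonneg: "0 \<le> filter_at t z"
  by (simp add: filter_at_def cutoff_nonneg)

lemma filter_at_cases: "filter_at t z = poly (res_at t) z \<or> filter_at t z = 0"
  by (auto simp: filter_at_def res_at_def cutoff_def)

lemma filter_at_0: "0 \<le> z \<Longrightarrow> filter_at 0 z = 1"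
  by (simp add: filter_at_def segment_def cutoff_def positive_to_0 mix_0)

lemma res_at_0: "res_at 0 = 1"
  by (simp add: res_at_def segment_def mix_0)

lemma res_at_D: "0 < D \<Longrightarrow> res_at (real D) = res D"
  using res_at_segment[of "D - 1" "real D"] by (simp add: of_nat_diff mix_1)

lemma filter_at_D: "0 < D \<Longrightarrow> i \<in> {1..D} \<Longrightarrow> filter_at (real D) (x i) = 0"
  using filter_at_cases[of "real D" "x i"] res_D_node[of i] by (simp add: res_at_D)

lemma energy_res_at_le: "0 < D \<Longrightarrow> 0 \<le> t \<Longrightarrow> t \<le> real D \<Longrightarrow>
    energy (res_at t) \<le> (\<Sum>i=1..D. w i * filter_at t (x i))"
  unfolding res_at_def filter_at_def by (intro energy_mix_le_cutoff segment_bounds)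

lemma filter_at_le_1: "0 < D \<Longrightarrow> 0 \<le> t \<Longrightarrow> t \<le> real D \<Longrightarrow> 0 \<le> z \<Longrightarrow> filter_at t z \<le> 1"
  unfolding filter_at_def by (intro cutoff_bounds segment_bounds)

text \<open>The index is matched to \<open>s\<close> through \<open>- r\<^sub>t'(0) = s\<close> if \<open>s \<le> - r\<^sub>d'(0)\<close>; otherwise \<open>t = d\<close> works.\<close>

lemma filter_at_matched:
  assumes "0 < D" "0 \<le> s"
  obtains t where "0 \<le> t" "t \<le> real D"
    "\<And>i. i \<in> {1..D} \<Longrightarrow> filter_at t (x i) \<le> exp (- s * x i)"
    "\<And>i. i \<in> {1..D} \<Longrightarrow> 1 - filter_at t (x i) \<le> min 1 (s * x i)"
proof -
  define sl where "sl t = slope (segment t) (t - real (segment t))" for t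
  have sl: "sl t = slope k (t - real k)" if "real k \<le> t" "t \<le> real k + 1" for k t
    unfolding sl_def using that by (intro segment_glue) (auto simp: slope_Suc)
  have cont: "continuous_on {0..real D} sl"
  proof (rule continuous_on_unit_intervals)
    fix k
    have "continuous_on {real k..real k + 1} (\<lambda>t. slope k (t - real k))"
      by (subst slope_mix) (intro continuous_intros)
    then show "continuous_on {real k..real k + 1} sl"
      by (rule continuous_on_eq) (simp add: sl[of k])
  qed
  have sl_bounds: "filter_at t z \<le> exp (- sl t * z)" "1 - filter_at t z \<le> sl t * z"
    if "0 \<le> t" "t \<le> real D" "0 \<le> z" for t z
    unfolding filter_at_def sl_def using that assms by (intro cutoff_bounds segment_bounds; simp)+
  have le1: "1 - filter_at t z \<le> 1" for t z :: real using filter_at_nonneg[of t z] by simp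
  show ?thesis
  proof (cases "s \<le> sl (real D)")
    case True
    have "sl 0 = 0" by (simp add: sl_def segment_def slope_0)
    then obtain t where "0 \<le> t" "t \<le> real D" "sl t = s"
      using IVT'[of sl 0 s "real D"] cont True assms by auto
    then show ?thesis using sl_bounds[of t] le1 x_pos by (intro that[of t]) (auto simp: less_imp_le)
  next
    case False
    \<comment> \<open>At \<open>D\<close> the filter vanishes at the nodes, so its linear bound
      reads \<open>1 <= sl (real D) * x i\<close>. For larger \<open>s\<close> the minimum is 1 and
      both required bounds are immediate.\<close>
    have "1 \<le> s * x i" if "i \<in> {1..D}" for i
    proof -
      have "1 \<le> sl (real D) * x i"
        using sl_bounds(2)[of "real D" "x i"] filter_at_D[OF assms(1) that] x_pos[OF that] by simp
      also have "\<dots> \<le> s * x i" using False x_pos[OF that] by (intro mult_right_mono) auto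
      finally show ?thesis .
    qed
    then show ?thesis using filter_at_D assms(1) by (intro that[of "real D"]) auto
  qed
qed

end

section \<open>The error terms and the balanced oracle in coordinates\<close>

locale cg_errors = cg_recursion D x "\<lambda>i. (g i + \<xi> i)\<^sup>2" for D x g \<xi>
begin

definition approx :: "real \<Rightarrow> real" where
  "approx t = (\<Sum>i=1..D. filter_at t (x i) * (g i)\<^sup>2) + energy (res_at t)
     - (\<Sum>i=1..D. filter_at t (x i) * (g i + \<xi> i)\<^sup>2)"

definition stoch :: "real \<Rightarrow> real" where
  "stoch t = (\<Sum>i=1..D. (1 - filter_at t (x i)) * (\<xi> i)\<^sup>2)"

definition balanced :: real where
  "balanced = Inf {t \<in> {0..real D}. approx t \<le> stoch t}"

definition loss :: "real \<Rightarrow> real" where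
  "loss t = (\<Sum>i=1..D. (\<xi> i - poly (res_at t) (x i) * (g i + \<xi> i))\<^sup>2)"

end

text \<open>Separate from \<open>cg_errors\<close>, whose definitions must make sense at every
  sample point for measurability; the positivity of the weights holds only almost surely.\<close>

locale cg_noise = cg_errors D x g \<xi> + cg_measure D x "\<lambda>i. (g i + \<xi> i)\<^sup>2" for D x g \<xi> +
  assumes D_pos: "0 < D"
begin

lemma continuous_on_approx: "continuous_on {0..real D} approx"
  unfolding approx_def energy_def
  by (intro continuous_intros continuous_on_filter_at continuous_on_poly_res_at)

lemma continuous_on_stoch: "continuous_on {0..real D} stoch"
  unfolding stoch_def by (intro continuous_intros continuous_on_filter_at)

text \<open>Coordinatewise. Where the filter equals the residual polynomial, the loss term is
  exactly the sum of the two error terms; where it is 0, the bound is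
  \<open>(a - b)^2 <= 2 (a^2 + b^2)\<close>.\<close>

lemma loss_le: "loss t \<le> 2 * (approx t + stoch t)"
proof -
  have termwise: "(\<xi> i - q * (g i + \<xi> i))\<^sup>2
      \<le> 2 * (p * (g i)\<^sup>2 + (g i + \<xi> i)\<^sup>2 * q\<^sup>2 - p * (g i + \<xi> i)\<^sup>2 + (1 - p) * (\<xi> i)\<^sup>2)"
    if "p = q \<or> p = 0" for p q i
  proof (cases "p = 0")
    case True
    have "(\<xi> i - q * (g i + \<xi> i))\<^sup>2 + (\<xi> i + q * (g i + \<xi> i))\<^sup>2
        = 2 * ((\<xi> i)\<^sup>2 + (g i + \<xi> i)\<^sup>2 * q\<^sup>2)" by (simp add: power2_eq_square algebra_simps)
    moreover have "0 \<le> (\<xi> i + q * (g i + \<xi> i))\<^sup>2" by simp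
    ultimately have "(\<xi> i - q * (g i + \<xi> i))\<^sup>2 \<le> 2 * ((\<xi> i)\<^sup>2 + (g i + \<xi> i)\<^sup>2 * q\<^sup>2)" by linarith
    then show ?thesis using True by simp
  next
    case False
    then have "p = q" using that by simp
    then have "p * (g i)\<^sup>2 + (g i + \<xi> i)\<^sup>2 * q\<^sup>2 - p * (g i + \<xi> i)\<^sup>2 + (1 - p) * (\<xi> i)\<^sup>2
        = (\<xi> i - q * (g i + \<xi> i))\<^sup>2"
      by (simp add: power2_eq_square algebra_simps)
    then show ?thesis using zero_le_power2[of "\<xi> i - q * (g i + \<xi> i)"] by simp
  qed
  have "loss t \<le> (\<Sum>i=1..D. 2 * (filter_at t (x i) * (g i)\<^sup>2 + (g i + \<xi> i)\<^sup>2 * (poly (res_at t) (x i))\<^sup>2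
      - filter_at t (x i) * (g i + \<xi> i)\<^sup>2 + (1 - filter_at t (x i)) * (\<xi> i)\<^sup>2))"
    unfolding loss_def by (intro sum_mono termwise filter_at_cases)
  also have "\<dots> = 2 * (approx t + stoch t)"
    unfolding approx_def stoch_def energy_def
    by (simp add: sum_distrib_left[symmetric] sum.distrib sum_subtractf)
  finally show ?thesis .
qed

lemma loss_nonneg: "0 \<le> loss t"
  unfolding loss_def by (intro sum_nonneg) simp

lemma approx_le: "0 \<le> t \<Longrightarrow> t \<le> real D \<Longrightarrow> approx t \<le> (\<Sum>i=1..D. filter_at t (x i) * (g i)\<^sup>2)"
  using energy_res_at_le[OF D_pos, of t] unfolding approx_def by (simp add: mult.commute)

text \<open>The set is closed by continuity. It contains \<open>D\<close>, where the filter vanishes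
  at the nodes and hence \<open>approx <= 0 <= stoch\<close>; so the infimum is attained.\<close>

lemma balanced_mem: "0 \<le> balanced" "balanced \<le> real D" "approx balanced \<le> stoch balanced"
proof -
  let ?B = "{t \<in> {0..real D}. approx t \<le> stoch t}"
  have 0: "filter_at (real D) (x i) = 0" if "i \<in> {1..D}" for i
    using filter_at_D[OF D_pos that] .
  have "approx (real D) \<le> (\<Sum>i=1..D. filter_at (real D) (x i) * (g i)\<^sup>2)"
    by (intro approx_le) auto
  also have "\<dots> = 0" using 0 by (intro sum.neutral) simp
  also have "0 \<le> stoch (real D)"
    unfolding stoch_def using 0 by (intro sum_nonneg) simp
  finally have "approx (real D) \<le> stoch (real D)" .
  then have "?B \<noteq> {}" by force
  moreover have "closed ?B"
  proof -
    have "?B = {0..real D} \<inter> (\<lambda>t. approx t - stoch t) -` {..0}" by auto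
    also have "closed \<dots>"
      by (intro continuous_closed_preimage continuous_on_diff continuous_on_approx continuous_on_stoch) auto
    finally show ?thesis .
  qed
  ultimately have "balanced \<in> ?B"
    unfolding balanced_def by (intro closed_contains_Inf) (auto intro: bdd_belowI[of _ 0])
  then show "0 \<le> balanced" "balanced \<le> real D" "approx balanced \<le> stoch balanced" by auto
qed

text \<open>To the left of the oracle \<open>stoch < approx\<close>, and continuity carries the weak
  inequality to the oracle. Positivity of \<open>balanced\<close> supplies the points on the
  left.\<close>

lemma stoch_le_approx_balanced:
  assumes "0 < balanced"
  shows "stoch balanced \<le> approx balanced"
proof -
  have "stoch t - approx t \<le> 0" if "t \<in> {0..<balanced}" for t
  proof (rule ccontr)
    assume "\<not> ?thesis"
    then have "balanced \<le> t"
      unfolding balanced_def using that balanced_mem(2) by (intro cInf_lower) (auto intro: bdd_belowI[of _ 0])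
    then show False using that by simp
  qed
  moreover have "closure {0..<balanced} = {0..balanced}" using assms by simp
  moreover have "continuous_on {0..balanced} (\<lambda>t. stoch t - approx t)"
    using balanced_mem(2)
    by (intro continuous_on_diff continuous_on_subset[OF continuous_on_approx]
        continuous_on_subset[OF continuous_on_stoch]) auto
  ultimately have "stoch balanced - approx balanced \<le> 0"
    using assms continuous_le_on_closure[of "{0..<balanced}" "\<lambda>t. stoch t - approx t" balanced 0] by simp
  then show ?thesis by simp
qed

lemma stoch_mono: "0 \<le> s \<Longrightarrow> s \<le> t \<Longrightarrow> t \<le> real D \<Longrightarrow> stoch s \<le> stoch t"
  unfolding stoch_def by (intro sum_mono mult_right_mono) (auto intro: filter_at_antimono)

text \<open>Take the index \<open>t\<close> matched to \<open>s\<close>. If the oracle is at most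
  \<open>t\<close>, monotonicity bounds \<open>stoch\<close>, the larger error; if it exceeds
  \<open>t\<close>, monotonicity of the filter bounds \<open>approx\<close>, and
  \<open>stoch\<close> is no larger. Adding the two errors gives the factor 2.\<close>

lemma balanced_bound:
  assumes "0 \<le> s"
  shows "approx balanced + stoch balanced
    \<le> 2 * ((\<Sum>i=1..D. exp (- s * x i) * (g i)\<^sup>2) + (\<Sum>i=1..D. min 1 (s * x i) * (\<xi> i)\<^sup>2))"
proof -
  obtain t where t: "0 \<le> t" "t \<le> real D"
    and bias: "\<And>i. i \<in> {1..D} \<Longrightarrow> filter_at t (x i) \<le> exp (- s * x i)"
    and var: "\<And>i. i \<in> {1..D} \<Longrightarrow> 1 - filter_at t (x i) \<le> min 1 (s * x i)"
    using filter_at_matched[OF D_pos assms] by blast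
  have b0: "0 \<le> (\<Sum>i=1..D. exp (- s * x i) * (g i)\<^sup>2)" by (intro sum_nonneg) simp
  have v0: "0 \<le> (\<Sum>i=1..D. min 1 (s * x i) * (\<xi> i)\<^sup>2)"
    using assms x_pos by (intro sum_nonneg mult_nonneg_nonneg) (auto simp: less_imp_le)
  show ?thesis
  proof (cases "balanced \<le> t")
    case True
    have "stoch balanced \<le> stoch t" using True t balanced_mem(1) by (intro stoch_mono)
    also have "\<dots> \<le> (\<Sum>i=1..D. min 1 (s * x i) * (\<xi> i)\<^sup>2)"
      unfolding stoch_def by (intro sum_mono mult_right_mono var) auto
    finally show ?thesis using balanced_mem(3) b0 by simp
  next
    case False
    have "approx balanced \<le> (\<Sum>i=1..D. filter_at balanced (x i) * (g i)\<^sup>2)"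
      using balanced_mem by (intro approx_le)
    also have "\<dots> \<le> (\<Sum>i=1..D. exp (- s * x i) * (g i)\<^sup>2)"
      using False t balanced_mem(2)
      by (intro sum_mono mult_right_mono order_trans[OF filter_at_antimono bias]) auto
    finally show ?thesis using stoch_le_approx_balanced False t v0 by simp
  qed
qed

end

section \<open>Coordinates with respect to the left singular vectors\<close>

locale singular_system =
  fixes D P :: nat and A :: "real mat" and lam :: "nat \<Rightarrow> real" and u :: "nat \<Rightarrow> real vec"
  assumes A_carrier: "A \<in> carrier_mat D P"
    and lss: "left_singular_system A lam u"
begin

lemma lam_pos: "i \<in> {1..D} \<Longrightarrow> 0 < lam i"
  and u_carrier: "i \<in> {1..D} \<Longrightarrow> u i \<in> carrier_vec D"
  and u_orthonormal: "i \<in> {1..D} \<Longrightarrow> j \<in> {1..D} \<Longrightarrow> u i \<bullet> u j = (if i = j then 1 else 0)"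
  using lss A_carrier unfolding left_singular_system_def Let_def by auto

text \<open>A one-sided inverse of a square matrix is two-sided, so orthonormal rows give
  orthonormal columns. \<open>Suc i\<close> reconciles matrix indices from 0 with singular vectors
  numbered from 1.\<close>

lemma u_complete:
  assumes "k < D" "l < D"
  shows "(\<Sum>i=1..D. u i $ k * u i $ l) = (if k = l then 1 else 0)"
proof -
  define V where "V = Matrix.mat D D (\<lambda>(i, k). u (Suc i) $ k)"
  define U where "U = Matrix.mat D D (\<lambda>(k, i). u (Suc i) $ k)"
  have "V * U = 1\<^sub>m D"
  proof (rule eq_matI)
    fix i j assume ij: "i < dim_row (1\<^sub>m D :: real mat)" "j < dim_col (1\<^sub>m D :: real mat)"
    then have "(V * U) $$ (i, j) = (\<Sum>k=0..<D. u (Suc i) $ k * u (Suc j) $ k)"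
      by (simp add: V_def U_def scalar_prod_def)
    also have "\<dots> = u (Suc i) \<bullet> u (Suc j)"
      using u_carrier[of "Suc j"] ij by (simp add: scalar_prod_def)
    finally show "(V * U) $$ (i, j) = 1\<^sub>m D $$ (i, j)"
      using u_orthonormal[of "Suc i" "Suc j"] ij by simp
  qed (simp_all add: V_def U_def)
  then have "U * V = 1\<^sub>m D"
    by (intro mat_mult_left_right_inverse[of V D U]) (simp_all add: V_def U_def)
  then have "(U * V) $$ (k, l) = (if k = l then 1 else 0)" using assms by simp
  moreover have "(U * V) $$ (k, l) = (\<Sum>i=1..D. u i $ k * u i $ l)"
    using assms by (simp add: V_def U_def scalar_prod_def sum.atLeast1_atMost_eq atLeast0LessThan)
  ultimately show ?thesis by simp
qed

lemma scalar_prod_u: "i \<in> {1..D} \<Longrightarrow> v \<bullet> u i = (\<Sum>k<D. v $ k * u i $ k)"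
  using u_carrier[of i] by (simp add: scalar_prod_def atLeast0LessThan)

text \<open>The sum runs over the \<open>D\<close> entries whatever the length of
  \<open>u i\<close>, so linearity and measurability hold for every \<open>i\<close>, also outside
  \<open>{1..D}\<close>; the coefficients enter \<open>cg_errors\<close> as total functions.\<close>

definition coord :: "real vec \<Rightarrow> nat \<Rightarrow> real" where
  "coord v i = (\<Sum>k<D. v $ k * u i $ k)"

lemma scalar_prod_coord: "i \<in> {1..D} \<Longrightarrow> v \<bullet> u i = coord v i"
  by (simp add: coord_def scalar_prod_u)

lemma coord_add: "v \<in> carrier_vec D \<Longrightarrow> w \<in> carrier_vec D \<Longrightarrow> coord (v + w) i = coord v i + coord w i"
  by (simp add: coord_def algebra_simps sum.distrib)

lemma coord_diff: "v \<in> carrier_vec D \<Longrightarrow> w \<in> carrier_vec D \<Longrightarrow> coord (v - w) i = coord v i - coord w i"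
  by (simp add: coord_def algebra_simps sum_subtractf)

lemma parseval:
  assumes "v \<in> carrier_vec D"
  shows "(vnorm v)\<^sup>2 = (\<Sum>i=1..D. (v \<bullet> u i)\<^sup>2)"
proof -
  have vv: "v \<bullet> v = (\<Sum>k<D. v $ k * v $ k)"
    using assms by (simp add: scalar_prod_def atLeast0LessThan)
  have "(\<Sum>i=1..D. (v \<bullet> u i)\<^sup>2) = (\<Sum>i=1..D. \<Sum>k<D. \<Sum>l<D. (v $ k * v $ l) * (u i $ k * u i $ l))"
    by (intro sum.cong) (simp_all add: scalar_prod_u power2_eq_square sum_product mult_ac)
  also have "\<dots> = (\<Sum>k<D. \<Sum>i=1..D. \<Sum>l<D. (v $ k * v $ l) * (u i $ k * u i $ l))"
    by (rule sum.swap)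
  also have "\<dots> = (\<Sum>k<D. \<Sum>l<D. \<Sum>i=1..D. (v $ k * v $ l) * (u i $ k * u i $ l))"
    by (intro sum.cong sum.swap refl)
  also have "\<dots> = (\<Sum>k<D. \<Sum>l<D. (v $ k * v $ l) * (if k = l then 1 else 0))"
    using u_complete by (intro sum.cong refl) (simp add: sum_distrib_left[symmetric])
  also have "\<dots> = v \<bullet> v" unfolding vv by (simp add: if_distrib cong: if_cong)
  finally have *: "(\<Sum>i=1..D. (v \<bullet> u i)\<^sup>2) = v \<bullet> v" .
  then have "0 \<le> v \<bullet> v" by (metis sum_nonneg zero_le_power2)
  then show ?thesis using * by (simp add: vnorm_def)
qed

lemma fcalc_carrier [simp]: "w \<in> carrier_vec D \<Longrightarrow> fcalc lam u h w \<in> carrier_vec D"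
  by (simp add: fcalc_def)

lemma fcalc_coordinate:
  assumes "w \<in> carrier_vec D" "j \<in> {1..D}"
  shows "fcalc lam u h w \<bullet> u j = h ((lam j)\<^sup>2) * (w \<bullet> u j)"
proof -
  have "fcalc lam u h w \<bullet> u j = (\<Sum>k<D. \<Sum>i=1..D. (h ((lam i)\<^sup>2) * (w \<bullet> u i)) * (u i $ k * u j $ k))"
    unfolding scalar_prod_u[OF assms(2)] using assms(1)
    by (intro sum.cong refl) (simp add: fcalc_def sum_distrib_right mult.assoc)
  also have "\<dots> = (\<Sum>i=1..D. \<Sum>k<D. (h ((lam i)\<^sup>2) * (w \<bullet> u i)) * (u i $ k * u j $ k))"
    by (rule sum.swap)
  also have "\<dots> = (\<Sum>i=1..D. (h ((lam i)\<^sup>2) * (w \<bullet> u i)) * (u i \<bullet> u j))"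
    using assms(2) by (simp add: scalar_prod_u sum_distrib_left)
  also have "\<dots> = (\<Sum>i=1..D. if i = j then h ((lam i)\<^sup>2) * (w \<bullet> u i) else 0)"
    using assms(2) by (intro sum.cong) (auto simp: u_orthonormal)
  also have "\<dots> = h ((lam j)\<^sup>2) * (w \<bullet> u j)" using assms(2) by simp
  finally show ?thesis .
qed

lemma vnorm_fcalc:
  "w \<in> carrier_vec D \<Longrightarrow> (vnorm (fcalc lam u h w))\<^sup>2 = (\<Sum>i=1..D. (h ((lam i)\<^sup>2))\<^sup>2 * (w \<bullet> u i)\<^sup>2)"
  by (simp add: parseval fcalc_coordinate power_mult_distrib)

text \<open>The \<open>u i\<close> are eigenvectors of the symmetric \<open>A A^T\<close> with
  eigenvalues \<open>(lam i)^2 > 0\<close>. A kernel vector is then orthogonal to all of them and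
  vanishes by \<open>parseval\<close>, so \<open>mat_inverse\<close> succeeds and the
  \<open>the\<close> in \<open>pinv\<close> is meaningful.\<close>

lemma pinv_right_inverse:
  assumes "w \<in> carrier_vec D"
  shows "A *\<^sub>v (pinv A *\<^sub>v w) = w" "pinv A *\<^sub>v w \<in> carrier_vec P"
proof -
  define M where "M = A * transpose_mat A"
  have At: "transpose_mat A \<in> carrier_mat P D" and M: "M \<in> carrier_mat D D"
    using A_carrier by (auto simp: M_def)
  have Mt: "transpose_mat M = M"
    using A_carrier At by (simp add: M_def transpose_mult)
  have "\<exists>v. (\<forall>i\<in>{1..D}. v i \<in> carrier_vec P) \<and>
      (\<forall>i\<in>{1..D}. \<forall>j\<in>{1..D}. v i \<bullet> v j = (if i = j then 1 else 0)) \<and>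
      (\<forall>i\<in>{1..D}. A *\<^sub>v v i = lam i \<cdot>\<^sub>v u i \<and> transpose_mat A *\<^sub>v u i = lam i \<cdot>\<^sub>v v i)"
    using lss unfolding left_singular_system_def Let_def carrier_matD[OF A_carrier] by blast
  then obtain v where v: "\<And>i. i \<in> {1..D} \<Longrightarrow> v i \<in> carrier_vec P"
      "\<And>i. i \<in> {1..D} \<Longrightarrow> A *\<^sub>v v i = lam i \<cdot>\<^sub>v u i"
      "\<And>i. i \<in> {1..D} \<Longrightarrow> transpose_mat A *\<^sub>v u i = lam i \<cdot>\<^sub>v v i"
    by blast
  have Mu: "M *\<^sub>v u i = (lam i)\<^sup>2 \<cdot>\<^sub>v u i" if i: "i \<in> {1..D}" for i
    using A_carrier At u_carrier[OF i] v[OF i]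
    by (simp add: M_def assoc_mult_mat_vec[of _ D P _ D] mult_mat_vec[of _ D P] smult_smult_assoc power2_eq_square)
  have "Determinant.det M \<noteq> 0"
  proof
    assume "Determinant.det M = 0"
    then obtain z where z: "z \<in> carrier_vec D" "z \<noteq> 0\<^sub>v D" "M *\<^sub>v z = 0\<^sub>v D"
      using det_0_iff_vec_prod_zero[OF M] by blast
    have "z \<bullet> u i = 0" if i: "i \<in> {1..D}" for i
    proof -
      have "(lam i)\<^sup>2 * (z \<bullet> u i) = z \<bullet> (M *\<^sub>v u i)"
        using z u_carrier[OF i] by (simp add: Mu[OF i])
      also have "\<dots> = (transpose_mat M *\<^sub>v z) \<bullet> u i"
        using transpose_vec_mult_scalar[OF M u_carrier[OF i] z(1)] by simp
      also have "\<dots> = 0" using u_carrier[OF i] z(3) by (simp add: Mt)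
      finally show ?thesis using lam_pos[OF i] by simp
    qed
    then have "(vnorm z)\<^sup>2 = 0" using parseval[OF z(1)] by simp
    moreover have "(vnorm z)\<^sup>2 = (\<Sum>k<D. (z $ k)\<^sup>2)"
      using z(1) by (simp add: vnorm_def scalar_prod_def atLeast0LessThan power2_eq_square sum_nonneg)
    ultimately have "\<forall>k<D. z $ k = 0" by (simp add: sum_nonneg_eq_0_iff)
    then have "z = 0\<^sub>v D" using z(1) by (intro eq_vecI) auto
    then show False using z(2) by simp
  qed
  then obtain B where B: "mat_inverse M = Some B"
    using mat_inverse(1)[OF M, where b = "()"] det_non_zero_imp_unit[OF M, where b = "()"]
    by (cases "mat_inverse M") auto
  then have inv: "M * B = 1\<^sub>m D" "B \<in> carrier_mat D D" using mat_inverse(2)[OF M B] by auto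
  have pinv: "pinv A = transpose_mat A * B" by (simp add: pinv_def M_def[symmetric] B)
  then have pc: "pinv A \<in> carrier_mat P D" using At inv by simp
  then show "pinv A *\<^sub>v w \<in> carrier_vec P" using assms by simp
  have "A *\<^sub>v (pinv A *\<^sub>v w) = (A * pinv A) *\<^sub>v w"
    using assoc_mult_mat_vec[OF A_carrier pc assms] by simp
  also have "A * pinv A = 1\<^sub>m D"
    unfolding pinv using assoc_mult_mat[OF A_carrier At inv(2)] inv(1) by (simp add: M_def)
  finally show "A *\<^sub>v (pinv A *\<^sub>v w) = w" using assms by simp
qed

end

locale distinct_singular_system = singular_system +
  assumes D_pos: "0 < D"
    and lam_distinct: "i \<in> {1..D} \<Longrightarrow> j \<in> {1..D} \<Longrightarrow> i < j \<Longrightarrow> lam j < lam i"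
begin

lemma lam_inj: "inj_on lam {1..D}"
  using lam_distinct by (intro inj_onI) (metis less_irrefl linorder_neqE_nat)

lemma lam_square_inj: "inj_on (\<lambda>i. (lam i)\<^sup>2) {1..D}"
proof (rule inj_onI)
  fix i j assume ij: "i \<in> {1..D}" "j \<in> {1..D}" "(lam i)\<^sup>2 = (lam j)\<^sup>2"
  then have "lam i = lam j" using lam_pos[of i] lam_pos[of j] by (simp add: power2_eq_iff_nonneg less_imp_le)
  then show "i = j" using lam_inj ij by (auto dest: inj_onD)
qed

lemma num_sv_eq: "num_sv lam D = D"
  using card_image[OF lam_inj] by (simp add: num_sv_def)

end

section \<open>The given estimators and errors identified with their coordinate forms, for a fixed
  generic noise vector\<close>

locale generic_observation = distinct_singular_system +
  fixes f \<xi> :: "real vec"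
  assumes f_carrier: "f \<in> carrier_vec P" and \<xi>_carrier: "\<xi> \<in> carrier_vec D"
    and generic: "i \<in> {1..D} \<Longrightarrow> (A *\<^sub>v f + \<xi>) \<bullet> u i \<noteq> 0"
begin

abbreviation Y :: "real vec" where "Y \<equiv> A *\<^sub>v f + \<xi>"

lemma g_carrier: "A *\<^sub>v f \<in> carrier_vec D" and Y_carrier: "Y \<in> carrier_vec D"
  using A_carrier f_carrier \<xi>_carrier by auto

lemma coord_Y: "coord Y i = coord (A *\<^sub>v f) i + coord \<xi> i"
  by (rule coord_add[OF g_carrier \<xi>_carrier])

sublocale cg_noise D "\<lambda>i. (lam i)\<^sup>2" "coord (A *\<^sub>v f)" "coord \<xi>"
proof unfold_locales
  fix i assume i: "i \<in> {1..D}"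
  show "0 < (lam i)\<^sup>2" using lam_pos[OF i] by simp
  show "0 < (coord (A *\<^sub>v f) i + coord \<xi> i)\<^sup>2"
    using generic[OF i] unfolding scalar_prod_coord[OF i] coord_Y by simp
qed (rule lam_square_inj, rule D_pos)

lemma is_cg_noise: "cg_noise D (\<lambda>i. (lam i)\<^sup>2) (coord (A *\<^sub>v f)) (coord \<xi>)"
  by unfold_locales

lemma vnorm_fcalc_Y: "(vnorm (fcalc lam u (poly p) Y))\<^sup>2 = energy p"
  unfolding vnorm_fcalc[OF Y_carrier] energy_def
  by (intro sum.cong) (simp_all add: scalar_prod_coord coord_Y mult.commute)

lemma cg_poly_eq: "k \<le> D \<Longrightarrow> cg_poly lam u Y k = res k"
  unfolding cg_poly_def vnorm_fcalc_Y by (rule res_unique_minimiser)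

lemma cg_interp_eq:
  assumes "0 \<le> t" "t \<le> real D"
  shows "cg_interp lam u Y t = res_at t"
proof (cases "t = 0")
  case True
  then show ?thesis by (simp add: cg_interp_def cg_poly_eq res_at_0)
next
  case False
  have "segment t < D" using segment_bounds assms D_pos by blast
  then show ?thesis
    using False assms cg_poly_eq[of "segment t"] cg_poly_eq[of "Suc (segment t)"]
    by (simp add: cg_interp_def res_at_def mix_def segment_def Let_def)
qed

lemma A_cg_est:
  assumes "0 \<le> t" "t \<le> real D"
  shows "A *\<^sub>v cg_est A lam u Y t = Y - fcalc lam u (poly (res_at t)) Y"
    "cg_est A lam u Y t \<in> carrier_vec P"
  unfolding cg_est_def cg_interp_eq[OF assms] using Y_carrier
  by (intro pinv_right_inverse; simp)+

lemma cg_residual_eq: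
  assumes "0 \<le> t" "t \<le> real D"
  shows "(cg_residual A lam u Y t)\<^sup>2 = energy (res_at t)"
proof -
  let ?F = "fcalc lam u (poly (res_at t)) Y"
  have F: "?F \<in> carrier_vec D" using Y_carrier by simp
  have "(Y - ?F - Y) \<bullet> u i = - (?F \<bullet> u i)" if "i \<in> {1..D}" for i
    using F Y_carrier u_carrier[OF that] by (simp add: minus_scalar_prod_distrib[of _ D])
  then have "(vnorm (Y - ?F - Y))\<^sup>2 = (vnorm ?F)\<^sup>2"
    using F Y_carrier by (simp add: parseval)
  then show ?thesis
    by (simp add: cg_residual_def A_cg_est[OF assms] vnorm_fcalc_Y)
qed

lemma cg_trunc_eq:
  assumes "0 \<le> t" "t \<le> real D" "0 \<le> z"
  shows "cg_trunc lam u Y t z = filter_at t z"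
proof (cases "t = 0")
  case True
  then show ?thesis using assms by (simp add: cg_trunc_def filter_at_0)
next
  case False
  have "segment t < D" "t - real (segment t) \<le> 1" using segment_bounds assms D_pos by blast+
  moreover have "0 < t - real (segment t)" using False assms unfolding segment_def by linarith
  ultimately show ?thesis
    using False cutoff_eq_least_zero[of "segment t" "t - real (segment t)" z] assms
    by (simp add: cg_trunc_def cg_zero_def cg_interp_eq filter_at_def res_at_def)
qed

text \<open>Lets the square roots in the two error terms cancel against the squared norms.\<close>

lemma filter_at_range:
  assumes "0 \<le> t" "t \<le> real D"
  shows "0 \<le> filter_at t ((lam i)\<^sup>2)" "filter_at t ((lam i)\<^sup>2) \<le> 1"
  using filter_at_nonneg filter_at_le_1[OF D_pos assms] by auto

lemma stoch_err_eq:
  assumes "0 \<le> t" "t \<le> real D"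
  shows "stoch_err lam u (A *\<^sub>v f) \<xi> t = stoch t"
  using filter_at_range[OF assms]
  by (simp add: stoch_err_def vnorm_fcalc[OF \<xi>_carrier] cg_trunc_eq[OF assms] stoch_def scalar_prod_coord)

lemma approx_err_eq:
  assumes "0 \<le> t" "t \<le> real D"
  shows "approx_err A lam u (A *\<^sub>v f) \<xi> t = approx t"
  using filter_at_range[OF assms]
  by (simp add: approx_err_def Let_def vnorm_fcalc[OF g_carrier] vnorm_fcalc[OF Y_carrier]
      cg_trunc_eq[OF assms] cg_residual_eq[OF assms] approx_def scalar_prod_coord coord_Y)

lemma balanced_oracle_eq: "balanced_oracle A lam u (A *\<^sub>v f) \<xi> = balanced"
proof -
  have "dim_row A = D" using A_carrier by simp
  then have "{t \<in> {0..real (num_sv lam (dim_row A))}.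
      approx_err A lam u (A *\<^sub>v f) \<xi> t \<le> stoch_err lam u (A *\<^sub>v f) \<xi> t}
    = {t \<in> {0..real D}. approx t \<le> stoch t}"
    using approx_err_eq stoch_err_eq num_sv_eq by auto
  then show ?thesis by (simp add: balanced_oracle_def balanced_def)
qed

lemma oracle_err_eq: "oracle_err A lam u f \<xi> = approx balanced + stoch balanced"
  using balanced_mem by (simp add: oracle_err_def Let_def balanced_oracle_eq approx_err_eq stoch_err_eq)

lemma cg_oracle_loss_eq: "cg_oracle_loss A lam u f \<xi> = loss balanced"
proof -
  let ?F = "fcalc lam u (poly (res_at balanced)) Y"
  have F: "?F \<in> carrier_vec D" using Y_carrier by simp
  note est = A_cg_est[OF balanced_mem(1,2)]
  have "A *\<^sub>v (cg_est A lam u Y balanced - f) = Y - ?F - A *\<^sub>v f"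
    using mult_minus_distrib_mat_vec[OF A_carrier est(2) f_carrier] est(1) by simp
  moreover have "(Y - ?F - A *\<^sub>v f) \<bullet> u i
      = coord \<xi> i - poly (res_at balanced) ((lam i)\<^sup>2) * (coord (A *\<^sub>v f) i + coord \<xi> i)"
    if i: "i \<in> {1..D}" for i
  proof -
    have "coord ?F i = poly (res_at balanced) ((lam i)\<^sup>2) * coord Y i"
      using fcalc_coordinate[OF Y_carrier i] unfolding scalar_prod_coord[OF i] .
    then show ?thesis
      unfolding scalar_prod_coord[OF i] using F Y_carrier g_carrier by (simp add: coord_diff coord_Y)
  qed
  ultimately show ?thesis
    using F Y_carrier g_carrier
    by (simp add: cg_oracle_loss_def Let_def balanced_oracle_eq parseval loss_def)
qed

end

context singular_system
begin

lemma showalter_loss_eq: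
  assumes f: "f \<in> carrier_vec P" and \<xi>: "\<xi> \<in> carrier_vec D"
  shows "(vnorm (A *\<^sub>v (showalter_est A lam u (A *\<^sub>v f + \<xi>) s - f)))\<^sup>2
    = (\<Sum>i=1..D. ((1 - exp (- s * (lam i)\<^sup>2)) * coord \<xi> i - exp (- s * (lam i)\<^sup>2) * coord (A *\<^sub>v f) i)\<^sup>2)"
proof -
  let ?Y = "A *\<^sub>v f + \<xi>" and ?h = "\<lambda>x. 1 - exp (- s * x)"
  let ?F = "fcalc lam u ?h ?Y"
  have g: "A *\<^sub>v f \<in> carrier_vec D" using A_carrier f by simp
  then have Y: "?Y \<in> carrier_vec D" using \<xi> by simp
  then have F: "?F \<in> carrier_vec D" by simp
  have "A *\<^sub>v (showalter_est A lam u ?Y s - f) = ?F - A *\<^sub>v f"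
    using mult_minus_distrib_mat_vec[OF A_carrier pinv_right_inverse(2)[OF F] f] pinv_right_inverse(1)[OF F]
    by (simp add: showalter_est_def)
  moreover have "(?F - A *\<^sub>v f) \<bullet> u i
      = (1 - exp (- s * (lam i)\<^sup>2)) * (\<xi> \<bullet> u i) - exp (- s * (lam i)\<^sup>2) * ((A *\<^sub>v f) \<bullet> u i)"
    if i: "i \<in> {1..D}" for i
  proof -
    have "(?F - A *\<^sub>v f) \<bullet> u i = ?F \<bullet> u i - (A *\<^sub>v f) \<bullet> u i"
      by (rule minus_scalar_prod_distrib[OF F g u_carrier[OF i]])
    also have "?F \<bullet> u i = (1 - exp (- s * (lam i)\<^sup>2)) * (?Y \<bullet> u i)"
      by (rule fcalc_coordinate[OF Y i])
    also have "?Y \<bullet> u i = (A *\<^sub>v f) \<bullet> u i + \<xi> \<bullet> u i"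
      by (rule add_scalar_prod_distrib[OF g \<xi> u_carrier[OF i]])
    finally show ?thesis by (simp add: algebra_simps)
  qed
  ultimately show ?thesis using F g by (simp add: parseval scalar_prod_coord)
qed

end

section \<open>Measurability and Gaussian linear forms\<close>

text \<open>Expresses the event \<open>balanced <= c\<close> through countably many evaluations: a
  continuous function on the compact interval \<open>[0, b]\<close> takes a nonpositive value iff,
  for every \<open>n\<close>, it falls below \<open>1 / (n + 1)\<close> at some rational multiple of
  \<open>b\<close>.\<close>

lemma (in cg_noise) balanced_le_iff:
  assumes "0 \<le> c"
  shows "balanced \<le> c \<longleftrightarrow> (\<forall>n. \<exists>m j. j \<le> m \<and>
    approx (min c (real D) * (real j / real m)) - stoch (min c (real D) * (real j / real m)) < inverse (real (Suc n)))"
proof -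
  define h where "h t = approx t - stoch t" for t
  define b where "b = min c (real D)"
  have b: "0 \<le> b" "b \<le> c" "b \<le> real D" using assms by (auto simp: b_def)
  have cont: "continuous_on {0..real D} h"
    unfolding h_def by (intro continuous_on_diff continuous_on_approx continuous_on_stoch)
  \<comment> \<open>For \<open>m = 0\<close> division by zero yields the grid point 0, which also
    lies in the interval.\<close>
  have grid: "0 \<le> b * (real j / real m) \<and> b * (real j / real m) \<le> b" if "j \<le> m" for j m
    using b(1) that by (intro conjI mult_left_le mult_nonneg_nonneg) (auto simp: divide_le_eq_1)
  have "\<exists>m j. j \<le> m \<and> h (b * (real j / real m)) < inverse (real (Suc n))" if le: "balanced \<le> c" for n
  proof -
    have t: "0 \<le> balanced" "balanced \<le> b" "h balanced \<le> 0"
      using balanced_mem le by (auto simp: b_def h_def)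
    obtain d where d: "0 < d" "\<And>s. s \<in> {0..real D} \<Longrightarrow> dist s balanced < d \<Longrightarrow> dist (h s) (h balanced) < inverse (real (Suc n))"
      using cont balanced_mem unfolding continuous_on_iff
      by (metis atLeastAtMost_iff inverse_positive_iff_positive of_nat_0_less_iff zero_less_Suc)
    obtain m :: nat where m: "b / d < real m" using reals_Archimedean2 by blast
    then have m0: "0 < real m" using d(1) b(1) by (meson divide_nonneg_pos order_le_less_trans)
    have "\<exists>j\<le>m. \<bar>b * (real j / real m) - balanced\<bar> < d"
    proof (cases "b = 0")
      case True
      then show ?thesis using t d(1) by (intro exI[of _ 0]) simp
    next
      case False
      \<comment> \<open>The grid point next below the oracle, at distance at most
        \<open>b / m < d\<close>.\<close>
      define j where "j = nat \<lfloor>real m * (balanced / b)\<rfloor>"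
      have nn: "0 \<le> real m * (balanced / b)" using t b by simp
      have j: "real j \<le> real m * (balanced / b)" "real m * (balanced / b) < real j + 1"
        unfolding j_def using nn by linarith+
      have "real m * (balanced / b) \<le> real m * 1"
        using t b False by (intro mult_left_mono) auto
      then have "j \<le> m" using j by linarith
      have e: "b * (real j / real m) - balanced = (b / real m) * (real j - real m * (balanced / b))"
        using False m0 by (simp add: field_simps)
      have "\<bar>b * (real j / real m) - balanced\<bar> \<le> b / real m * 1"
        unfolding e abs_mult using j b m0 by (intro mult_mono) auto
      also have "\<dots> < d" using m m0 d(1) by (simp add: field_simps)
      finally show ?thesis using \<open>j \<le> m\<close> by blast
    qed
    then obtain j where j: "j \<le> m" "\<bar>b * (real j / real m) - balanced\<bar> < d" by blast
    have "dist (h (b * (real j / real m))) (h balanced) < inverse (real (Suc n))"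
      using grid[OF j(1)] b j(2) by (intro d(2)) (auto simp: dist_real_def)
    then show ?thesis using j(1) t(3) by (intro exI[of _ m] exI[of _ j]) (auto simp: dist_real_def)
  qed
  moreover have "balanced \<le> c" if small: "\<forall>n. \<exists>m j. j \<le> m \<and> h (b * (real j / real m)) < inverse (real (Suc n))"
  proof -
    have "continuous_on {0..b} h" using cont b by (auto intro: continuous_on_subset)
    then obtain s where s: "s \<in> {0..b}" "\<And>t. t \<in> {0..b} \<Longrightarrow> h s \<le> h t"
      using continuous_attains_inf[of "{0..b}" h] b by auto
    have "h s \<le> 0"
    proof (rule ccontr)
      assume "\<not> h s \<le> 0"
      then obtain n where "inverse (real (Suc n)) < h s" using reals_Archimedean[of "h s"] by auto
      moreover obtain m j where "j \<le> m" "h (b * (real j / real m)) < inverse (real (Suc n))"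
        using small by blast
      ultimately show False using s(2)[of "b * (real j / real m)"] grid[of j m] by auto
    qed
    then have "balanced \<le> s"
      unfolding balanced_def using s(1) b by (intro cInf_lower) (auto simp: h_def intro: bdd_belowI[of _ 0])
    then show ?thesis using s(1) b by simp
  qed
  ultimately show ?thesis unfolding h_def b_def by (intro iffI allI)
qed

section \<open>Measurability of the recursion, the errors and the oracle\<close>

lemma measurable_res_dir:
  assumes "\<And>i. (\<lambda>\<omega>. w \<omega> i) \<in> borel_measurable M"
  shows "(\<lambda>\<omega>. poly (cg_recursion.res D x (w \<omega>) k) z) \<in> borel_measurable M"
    and "(\<lambda>\<omega>. poly (cg_recursion.dir D x (w \<omega>) k) z) \<in> borel_measurable M"
proof -
  note [measurable] = assms
  have "\<forall>z. (\<lambda>\<omega>. poly (cg_recursion.res D x (w \<omega>) k) z) \<in> borel_measurable M \<and>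
      (\<lambda>\<omega>. poly (cg_recursion.dir D x (w \<omega>) k) z) \<in> borel_measurable M"
  proof (induction k)
    case 0
    then show ?case by (simp add: cg_recursion.res_0 cg_recursion.dir_0)
  next
    case (Suc k)
    have r [measurable]: "(\<lambda>\<omega>. poly (cg_recursion.res D x (w \<omega>) k) z) \<in> borel_measurable M"
      and p [measurable]: "(\<lambda>\<omega>. poly (cg_recursion.dir D x (w \<omega>) k) z) \<in> borel_measurable M" for z
      using Suc by auto
    have r' [measurable]: "(\<lambda>\<omega>. poly (cg_recursion.res D x (w \<omega>) (Suc k)) z) \<in> borel_measurable M" for z
      unfolding cg_recursion.res_Suc cg_recursion.step_def cg_recursion.ip_def by simp
    have "(\<lambda>\<omega>. poly (cg_recursion.dir D x (w \<omega>) (Suc k)) z) \<in> borel_measurable M" for z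
      unfolding cg_recursion.dir_Suc cg_recursion.coupling_def cg_recursion.ip_def by simp
    then show ?case using r' by blast
  qed
  then show "(\<lambda>\<omega>. poly (cg_recursion.res D x (w \<omega>) k) z) \<in> borel_measurable M"
    "(\<lambda>\<omega>. poly (cg_recursion.dir D x (w \<omega>) k) z) \<in> borel_measurable M" by auto
qed

text \<open>The index may be random: its segment takes countably many values, and for fixed
  \<open>k\<close> only polynomial values at \<open>z\<close> and their signs enter.\<close>

lemma measurable_res_filter_at:
  assumes w: "\<And>i. (\<lambda>\<omega>. w \<omega> i) \<in> borel_measurable M" and T [measurable]: "T \<in> borel_measurable M"
  shows "(\<lambda>\<omega>. poly (cg_recursion.res_at D x (w \<omega>) (T \<omega>)) z) \<in> borel_measurable M"
    and "(\<lambda>\<omega>. cg_recursion.filter_at D x (w \<omega>) (T \<omega>) z) \<in> borel_measurable M"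
proof -
  note [measurable] = measurable_res_dir(1)[OF w]
  have seg [measurable]: "(\<lambda>\<omega>. segment (T \<omega>)) \<in> measurable M (count_space UNIV)"
    unfolding segment_def by measurable
  have mix [measurable]: "(\<lambda>\<omega>. poly (cg_recursion.mix D x (w \<omega>) k (T \<omega> - real k)) z) \<in> borel_measurable M" for k
    unfolding cg_recursion.mix_def by simp
  show "(\<lambda>\<omega>. poly (cg_recursion.res_at D x (w \<omega>) (T \<omega>)) z) \<in> borel_measurable M"
    unfolding cg_recursion.res_at_def
    by (rule measurable_compose_countable[OF mix seg])
  have "(\<lambda>\<omega>. cg_recursion.cutoff D x (w \<omega>) k (T \<omega> - real k) z) \<in> borel_measurable M" for k
    unfolding cg_recursion.cutoff_def cg_recursion.positive_to_def mem_Collect_eq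
    by measurable
  from measurable_compose_countable[OF this seg]
  show "(\<lambda>\<omega>. cg_recursion.filter_at D x (w \<omega>) (T \<omega>) z) \<in> borel_measurable M"
    unfolding cg_recursion.filter_at_def .
qed

lemma measurable_cg_errors:
  assumes \<xi>: "\<And>i. (\<lambda>\<omega>. \<xi> \<omega> i) \<in> borel_measurable M" and T: "T \<in> borel_measurable M"
  shows "(\<lambda>\<omega>. cg_errors.approx D x g (\<xi> \<omega>) (T \<omega>)) \<in> borel_measurable M"
    "(\<lambda>\<omega>. cg_errors.stoch D x g (\<xi> \<omega>) (T \<omega>)) \<in> borel_measurable M"
    "(\<lambda>\<omega>. cg_errors.loss D x g (\<xi> \<omega>) (T \<omega>)) \<in> borel_measurable M"
proof -
  note [measurable] = \<xi>
  have w: "(\<lambda>\<omega>. (g i + \<xi> \<omega> i)\<^sup>2) \<in> borel_measurable M" for i by measurable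
  note [measurable] = measurable_res_filter_at[OF w T]
  show "(\<lambda>\<omega>. cg_errors.approx D x g (\<xi> \<omega>) (T \<omega>)) \<in> borel_measurable M"
    unfolding cg_errors.approx_def cg_recursion.energy_def by measurable
  show "(\<lambda>\<omega>. cg_errors.stoch D x g (\<xi> \<omega>) (T \<omega>)) \<in> borel_measurable M"
    unfolding cg_errors.stoch_def by measurable
  show "(\<lambda>\<omega>. cg_errors.loss D x g (\<xi> \<omega>) (T \<omega>)) \<in> borel_measurable M"
    unfolding cg_errors.loss_def by measurable
qed

lemma measurable_balanced:
  assumes \<xi>: "\<And>i. (\<lambda>\<omega>. \<xi> \<omega> i) \<in> borel_measurable M"
    and G: "Measurable.pred M G" and noise: "\<And>\<omega>. \<omega> \<in> space M \<Longrightarrow> G \<omega> \<Longrightarrow> cg_noise D x g (\<xi> \<omega>)"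
  shows "(\<lambda>\<omega>. if G \<omega> then cg_errors.balanced D x g (\<xi> \<omega>) else 0) \<in> borel_measurable M"
  unfolding borel_measurable_iff_le
proof
  fix c :: real
  note [measurable] = measurable_cg_errors(1,2)[OF \<xi> measurable_const] G
  let ?T = "\<lambda>\<omega>. if G \<omega> then cg_errors.balanced D x g (\<xi> \<omega>) else 0"
  let ?h = "\<lambda>\<omega> t. cg_errors.approx D x g (\<xi> \<omega>) t - cg_errors.stoch D x g (\<xi> \<omega>) t"
  show "{\<omega> \<in> space M. ?T \<omega> \<le> c} \<in> sets M"
  proof (cases "0 \<le> c")
    case True
    have "{\<omega> \<in> space M. ?T \<omega> \<le> c} = {\<omega> \<in> space M. \<not> G \<omega> \<or> (\<forall>n. \<exists>m j. j \<le> m \<and>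
        ?h \<omega> (min c (real D) * (real j / real m)) < inverse (real (Suc n)))}"
      using True cg_noise.balanced_le_iff[OF noise True] by auto
    also have "\<dots> \<in> sets M" by measurable
    finally show ?thesis .
  next
    case False
    have "0 \<le> ?T \<omega>" if "\<omega> \<in> space M" for \<omega>
      using cg_noise.balanced_mem(1)[OF noise[OF that]] by simp
    then have "{\<omega> \<in> space M. ?T \<omega> \<le> c} = {}" using False by fastforce
    then show ?thesis by (metis sets.empty_sets)
  qed
qed

text \<open>On the exceptional null set the \<open>THE\<close> in \<open>cg_poly\<close> has
  unspecified values. In the completion, a function almost everywhere equal to a measurable one is
  measurable.\<close>

lemma completion_AE_transfer:
  fixes f f' :: "'a \<Rightarrow> real"
  assumes f': "integrable M f'" and ae: "AE \<omega> in M. f \<omega> = f' \<omega>"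
  shows "integrable (completion M) f" "integral\<^sup>L (completion M) f = integral\<^sup>L M f'"
proof -
  have ae': "AE \<omega> in completion M. f' \<omega> = f \<omega>" using AE_completion[OF ae] by eventually_elim simp
  have m': "f' \<in> borel_measurable (completion M)"
    using f' by (intro measurable_completion) simp
  have m: "f \<in> borel_measurable (completion M)"
    unfolding borel_measurable_iff_le
  proof
    fix c
    show "{\<omega> \<in> space (completion M). f \<omega> \<le> c} \<in> sets (completion M)"
    proof (rule complete_measure.in_sets_AE[OF completion.complete_measure_axioms])
      show "AE \<omega> in completion M. \<omega> \<in> {\<omega> \<in> space (completion M). f' \<omega> \<le> c}
          \<longleftrightarrow> \<omega> \<in> {\<omega> \<in> space (completion M). f \<omega> \<le> c}"
        using ae' by eventually_elim simp
    qed (use m' in \<open>auto simp: borel_measurable_iff_le\<close>)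
  qed
  show "integrable (completion M) f"
    using f' integrable_cong_AE[OF m' m ae'] integrable_completion[of f' M] by auto
  show "integral\<^sup>L (completion M) f = integral\<^sup>L M f'"
    using f' integral_cong_AE[OF m' m ae'] integral_completion[of f' M] by auto
qed

section \<open>Linear forms of a standard Gaussian vector\<close>

abbreviation gaussian_product :: "nat \<Rightarrow> (nat \<Rightarrow> real) measure" where
  "gaussian_product D \<equiv> PiM {..<D} (\<lambda>_. density lborel (\<lambda>x. ennreal (std_normal_density x)))"

lemma prob_space_gaussian_product: "prob_space (gaussian_product D)"
  by (intro prob_space_PiM prob_space_normal_density) simp

lemma distributed_gaussian_linear_form:
  assumes v: "(\<Sum>k<D. (v k)\<^sup>2) = 1"
  shows "distributed (gaussian_product D) lborel (\<lambda>\<omega>. \<Sum>k<D. v k * \<omega> k) std_normal_density"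
proof -
  let ?N = "density lborel (\<lambda>x. ennreal (std_normal_density x))" and ?M = "gaussian_product D"
  have N: "prob_space ?N" by (rule prob_space_normal_density) simp
  interpret prob_space ?M by (rule prob_space_gaussian_product)
  \<comment> \<open>Coordinates with coefficient 0 are dropped: their contribution is constant and
    has no density.\<close>
  define K where "K = {k \<in> {..<D}. v k \<noteq> 0}"
  have "K \<noteq> {}"
  proof
    assume "K = {}"
    then have "(\<Sum>k<D. (v k)\<^sup>2) = 0" by (intro sum.neutral) (auto simp: K_def)
    then show False using v by simp
  qed
  then have ne: "{..<D} \<noteq> {}" by (auto simp: K_def)
  have comp: "distr ?M ?N (\<lambda>\<omega>. \<omega> k) = ?N" if "k < D" for k
    using distr_PiM_component[of "{..<D}" "\<lambda>_. ?N" k] N that by simp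
  \<comment> \<open>Restriction is the identity on the product space, so the joint law is the
    product of its marginals, which is independence.\<close>
  have "distr ?M ?M (\<lambda>\<omega>. restrict \<omega> {..<D}) = distr ?M ?M (\<lambda>\<omega>. \<omega>)"
    by (intro distr_cong) (auto simp: space_PiM PiE_restrict)
  also have "\<dots> = ?M" by (rule distr_id2) simp
  also have "\<dots> = PiM {..<D} (\<lambda>k. distr ?M ?N (\<lambda>\<omega>. \<omega> k))"
    using comp by (intro PiM_cong) auto
  finally have "indep_vars (\<lambda>_. ?N) (\<lambda>k \<omega>. \<omega> k) {..<D}"
    using ne by (subst indep_vars_iff_distr_eq_PiM') auto
  then have "indep_vars (\<lambda>_. borel) (\<lambda>k \<omega>. v k * \<omega> k) {..<D}"
    by (rule indep_vars_compose2) simp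
  then have indep: "indep_vars (\<lambda>_. borel) (\<lambda>k \<omega>. v k * \<omega> k) K"
    by (rule indep_vars_subset) (auto simp: K_def)
  have dist: "distributed ?M lborel (\<lambda>\<omega>. v k * \<omega> k) (normal_density 0 \<bar>v k\<bar>)" if k: "k \<in> K" for k
  proof -
    have "distr ?M lborel (\<lambda>\<omega>. \<omega> k) = distr ?M ?N (\<lambda>\<omega>. \<omega> k)"
      by (intro distr_cong) simp_all
    then have "distributed ?M lborel (\<lambda>\<omega>. \<omega> k) std_normal_density"
      using comp[of k] k by (auto simp: distributed_def K_def intro!: measurable_component_singleton)
    then show ?thesis
      using normal_density_affine[of "\<lambda>\<omega>. \<omega> k" 0 1 "v k" 0] k by (simp add: K_def)
  qed
  have "distributed ?M lborel (\<lambda>\<omega>. \<Sum>k\<in>K. v k * \<omega> k)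
      (normal_density (\<Sum>k\<in>K. 0) (sqrt (\<Sum>k\<in>K. \<bar>v k\<bar>\<^sup>2)))"
    using \<open>K \<noteq> {}\<close> indep dist by (intro sum_indep_normal) (auto simp: K_def)
  moreover have "(\<Sum>k\<in>K. v k * \<omega> k) = (\<Sum>k<D. v k * \<omega> k)" for \<omega> :: "nat \<Rightarrow> real"
    by (intro sum.mono_neutral_left) (auto simp: K_def)
  moreover have "(\<Sum>k\<in>K. \<bar>v k\<bar>\<^sup>2) = (\<Sum>k<D. (v k)\<^sup>2)"
    unfolding power2_abs by (intro sum.mono_neutral_left) (auto simp: K_def)
  ultimately show ?thesis using v by simp
qed

lemma (in prob_space) std_normal_facts:
  assumes X: "distributed M lborel X std_normal_density"
  shows "integrable M X" "expectation X = 0" "integrable M (\<lambda>\<omega>. (X \<omega>)\<^sup>2)"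
    "expectation (\<lambda>\<omega>. (X \<omega>)\<^sup>2) = 1" "AE \<omega> in M. X \<omega> \<noteq> c"
proof -
  show "integrable M X"
    using distributed_integrable[OF X, of "\<lambda>x. x"] integrable_std_normal_moment[of 1] by simp
  show 0: "expectation X = 0" by (rule standard_normal_distributed_expectation[OF X])
  show "integrable M (\<lambda>\<omega>. (X \<omega>)\<^sup>2)"
    using distributed_integrable[OF X, of "\<lambda>x. x\<^sup>2"] integrable_std_normal_moment[of 2] by simp
  show "expectation (\<lambda>\<omega>. (X \<omega>)\<^sup>2) = 1"
    using standard_normal_distributed_variance[OF X] 0 by simp
  have "AE x in lborel. 0 < ennreal (std_normal_density x) \<longrightarrow> x \<noteq> c"
    using AE_lborel_singleton[of c] by eventually_elim simp
  then show "AE \<omega> in M. X \<omega> \<noteq> c"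
    using distributed_AE2[OF X, of "\<lambda>x. x \<noteq> c"] by simp
qed

section \<open>Expectations\<close>

text \<open>Both sides are compared with the last index \<open>j\<close> such that
  \<open>s * x j >= 1\<close>. The left side is at most \<open>2 (1 + 2 c) j\<close>; on the right
  each of the first \<open>j\<close> squares is at least \<open>1 / 4\<close>, whence the factor
  8.\<close>

lemma sum_min_le_sum_square:
  fixes x :: "nat \<Rightarrow> real"
  assumes "1 \<le> D" "0 \<le> c" "0 \<le> s" "1 \<le> s * x 1"
    and pos: "\<And>i. i \<in> {1..D} \<Longrightarrow> 0 < x i"
    and dec: "\<And>i j. i \<in> {1..D} \<Longrightarrow> j \<in> {1..D} \<Longrightarrow> i \<le> j \<Longrightarrow> x j \<le> x i"
    and tail: "\<And>j. j \<in> {2..D} \<Longrightarrow> (\<Sum>i=j..D. x i) \<le> c * real j * x j"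
  shows "(\<Sum>i=1..D. min 1 (2 * s * x i)) \<le> 8 * (1 + 2 * c) * (\<Sum>i=1..D. (1 - exp (- s * x i))\<^sup>2)"
proof -
  let ?J = "{i \<in> {1..D}. 1 \<le> s * x i}"
  define j where "j = Max ?J"
  have "1 \<in> ?J" using assms by simp
  then have "?J \<noteq> {}" "finite ?J" by auto
  then have j: "j \<in> {1..D}" "1 \<le> s * x j" and max: "\<And>i. i \<in> {1..D} \<Longrightarrow> 1 \<le> s * x i \<Longrightarrow> i \<le> j"
    using Max_in[of ?J] by (auto simp: j_def)
  have large: "1 \<le> s * x i" if "i \<in> {1..j}" for i
    using j dec[of i j] that mult_left_mono[of "x j" "x i" s] assms(3) by auto
  have split: "{1..D} = {1..j} \<union> {Suc j..D}" using j(1) by auto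
  \<comment> \<open>The decay condition is applied at \<open>Suc j >= 2\<close>, where
    \<open>s * x (Suc j) < 1\<close> by maximality of \<open>j\<close>; then
    \<open>Suc j <= 2 * j\<close>.\<close>
  have rest: "s * (\<Sum>i=Suc j..D. x i) \<le> 2 * c * real j"
  proof (cases "j < D")
    case True
    then have "s * (\<Sum>i=Suc j..D. x i) \<le> s * (c * real (Suc j) * x (Suc j))"
      using tail[of "Suc j"] j(1) assms(3) by (intro mult_left_mono) auto
    also have "\<dots> = (c * real (Suc j)) * (s * x (Suc j))" by simp
    also have "\<dots> \<le> (c * real (Suc j)) * 1"
      using max[of "Suc j"] True assms(2) by (intro mult_left_mono) force+
    also have "\<dots> \<le> c * (2 * real j)" using j(1) assms(2) by (simp add: mult_left_mono del: of_nat_Suc)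
    finally show ?thesis by simp
  qed (use assms(2) in auto)
  have "(\<Sum>i=1..D. min 1 (2 * s * x i)) \<le> (\<Sum>i\<in>{1..D}. 2 * min 1 (s * x i))"
    using pos assms(3) by (intro sum_mono) (auto simp: min_def)
  also have "\<dots> = (\<Sum>i\<in>{1..j}. 2 * min 1 (s * x i)) + (\<Sum>i\<in>{Suc j..D}. 2 * min 1 (s * x i))"
    unfolding split by (intro sum.union_disjoint) auto
  also have "(\<Sum>i\<in>{1..j}. 2 * min 1 (s * x i)) \<le> (\<Sum>i\<in>{1..j}. 2)" by (intro sum_mono) auto
  also have "(\<Sum>i\<in>{Suc j..D}. 2 * min 1 (s * x i)) \<le> (\<Sum>i\<in>{Suc j..D}. 2 * (s * x i))"
    by (intro sum_mono) auto
  also have "\<dots> = 2 * (s * (\<Sum>i=Suc j..D. x i))" by (simp add: sum_distrib_left)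
  finally have lhs: "(\<Sum>i=1..D. min 1 (2 * s * x i)) \<le> 2 * (1 + 2 * c) * real j"
    using rest by (simp add: algebra_simps)
  have half: "1 / 2 \<le> 1 - exp (- s * x i)" if "i \<in> {1..j}" for i
  proof -
    have "2 \<le> exp (s * x i)" using exp_ge_add_one_self[of "s * x i"] large[OF that] by linarith
    then show ?thesis by (simp add: exp_minus field_simps)
  qed
  have "real j / 4 = (\<Sum>i\<in>{1..j}. (1 / 2)\<^sup>2)" by (simp add: power2_eq_square)
  also have "\<dots> \<le> (\<Sum>i\<in>{1..j}. (1 - exp (- s * x i))\<^sup>2)"
    using half by (intro sum_mono power_mono) auto
  also have "\<dots> \<le> (\<Sum>i=1..D. (1 - exp (- s * x i))\<^sup>2)"
    using split by (intro sum_mono2) auto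
  finally have "8 * (1 + 2 * c) * (real j / 4) \<le> 8 * (1 + 2 * c) * (\<Sum>i=1..D. (1 - exp (- s * x i))\<^sup>2)"
    using assms(2) by (intro mult_left_mono) auto
  moreover have "2 * (1 + 2 * c) * real j = 8 * (1 + 2 * c) * (real j / 4)" by simp
  ultimately show ?thesis using lhs by linarith
qed

lemma noise_carrier: "noise D \<delta> \<omega> \<in> carrier_vec D"
  by (simp add: noise_def)

lemma (in singular_system) coord_noise: "coord (noise D \<delta> \<omega>) i = \<delta> * (\<Sum>k<D. u i $ k * \<omega> k)"
  unfolding coord_def sum_distrib_left by (intro sum.cong) (simp_all add: noise_def)

section \<open>Risk of the Showalter estimator and expected errors of the oracle\<close>

context distinct_singular_system
begin

lemma std_gaussian_eq: "std_gaussian D = completion (gaussian_product D)"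
  by (simp add: std_gaussian_def)

sublocale gauss: prob_space "gaussian_product D"
  by (rule prob_space_gaussian_product)

lemma coord_noise_measurable: "(\<lambda>\<omega>. coord (noise D \<delta> \<omega>) i) \<in> borel_measurable (gaussian_product D)"
  unfolding coord_noise by measurable

lemma distributed_u: "i \<in> {1..D} \<Longrightarrow>
    distributed (gaussian_product D) lborel (\<lambda>\<omega>. \<Sum>k<D. u i $ k * \<omega> k) std_normal_density"
  using u_orthonormal[of i i] by (intro distributed_gaussian_linear_form) (simp add: scalar_prod_u power2_eq_square)

lemma coord_noise_moments:
  assumes "i \<in> {1..D}"
  shows "integrable (gaussian_product D) (\<lambda>\<omega>. coord (noise D \<delta> \<omega>) i)"
    "gauss.expectation (\<lambda>\<omega>. coord (noise D \<delta> \<omega>) i) = 0"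
    "integrable (gaussian_product D) (\<lambda>\<omega>. (coord (noise D \<delta> \<omega>) i)\<^sup>2)"
    "gauss.expectation (\<lambda>\<omega>. (coord (noise D \<delta> \<omega>) i)\<^sup>2) = \<delta>\<^sup>2"
  using gauss.std_normal_facts[OF distributed_u[OF assms]]
  by (simp_all add: coord_noise power_mult_distrib)

text \<open>Bias-variance decomposition; the cross terms are linear in centred noise. Squaring
  \<open>exp (- s x)\<close> doubles the time, which is why the pathwise bound is later used at
  \<open>2 * s\<close>.\<close>

lemma showalter_risk_eq:
  assumes f: "f \<in> carrier_vec P"
  shows "showalter_risk A lam u f \<delta> s = (\<Sum>i=1..D. exp (- (2 * s) * (lam i)\<^sup>2) * (coord (A *\<^sub>v f) i)\<^sup>2)
      + \<delta>\<^sup>2 * (\<Sum>i=1..D. (1 - exp (- s * (lam i)\<^sup>2))\<^sup>2)"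
proof -
  define e where "e i = exp (- s * (lam i)\<^sup>2)" for i
  define g where "g = coord (A *\<^sub>v f)"
  let ?\<xi> = "\<lambda>\<omega>. coord (noise D \<delta> \<omega>)"
  note [measurable] = coord_noise_measurable
  have square: "(e i)\<^sup>2 = exp (- (2 * s) * (lam i)\<^sup>2)" for i
    by (simp add: e_def exp_double[symmetric] mult.assoc)
  have "dim_row A = D" using A_carrier by simp
  then have "showalter_risk A lam u f \<delta> s
    = (\<integral>\<omega>. (\<Sum>i=1..D. ((1 - e i) * ?\<xi> \<omega> i - e i * g i)\<^sup>2) \<partial>std_gaussian D)"
    by (simp add: showalter_risk_def showalter_loss_eq[OF f noise_carrier] e_def g_def)
  also have "\<dots> = (\<integral>\<omega>. (\<Sum>i=1..D. ((1 - e i) * ?\<xi> \<omega> i - e i * g i)\<^sup>2) \<partial>gaussian_product D)"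
    unfolding std_gaussian_eq by (intro integral_completion) measurable
  also have "\<dots> = (\<integral>\<omega>. (\<Sum>i=1..D. (1 - e i)\<^sup>2 * (?\<xi> \<omega> i)\<^sup>2 - 2 * (1 - e i) * e i * g i * ?\<xi> \<omega> i
      + (e i)\<^sup>2 * (g i)\<^sup>2) \<partial>gaussian_product D)"
    by (intro Bochner_Integration.integral_cong sum.cong) (simp_all add: power2_eq_square algebra_simps)
  also have "\<dots> = (\<Sum>i=1..D. (1 - e i)\<^sup>2 * \<delta>\<^sup>2 + (e i)\<^sup>2 * (g i)\<^sup>2)"
    using coord_noise_moments
    by (subst Bochner_Integration.integral_sum) (auto intro!: sum.cong simp: gauss.prob_space)
  also have "\<dots> = (\<Sum>i=1..D. (e i)\<^sup>2 * (g i)\<^sup>2) + \<delta>\<^sup>2 * (\<Sum>i=1..D. (1 - e i)\<^sup>2)"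
    by (simp add: sum.distrib sum_distrib_left mult.commute add.commute)
  finally show ?thesis by (simp only: square) (simp add: e_def g_def)
qed

text \<open>The pathwise results hold on the event \<open>G\<close> of probability 1. The surrogates
  \<open>err\<close> and \<open>ls\<close>, with index 0 off \<open>G\<close>, are measurable for
  the uncompleted product, and \<open>completion_AE_transfer\<close> moves their integrals to
  \<open>std_gaussian\<close>.\<close>

lemma balanced_oracle_expectation:
  assumes f: "f \<in> carrier_vec P" and \<delta>: "0 < \<delta>"
  shows "integrable (std_gaussian D) (\<lambda>\<omega>. cg_oracle_loss A lam u f (noise D \<delta> \<omega>))"
    and "integrable (std_gaussian D) (\<lambda>\<omega>. oracle_err A lam u f (noise D \<delta> \<omega>))"
    and "(\<integral>\<omega>. cg_oracle_loss A lam u f (noise D \<delta> \<omega>) \<partial>std_gaussian D)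
      \<le> 2 * (\<integral>\<omega>. oracle_err A lam u f (noise D \<delta> \<omega>) \<partial>std_gaussian D)"
    and "0 \<le> s \<Longrightarrow> (\<integral>\<omega>. oracle_err A lam u f (noise D \<delta> \<omega>) \<partial>std_gaussian D)
      \<le> 2 * ((\<Sum>i=1..D. exp (- s * (lam i)\<^sup>2) * (coord (A *\<^sub>v f) i)\<^sup>2)
        + \<delta>\<^sup>2 * (\<Sum>i=1..D. min 1 (s * (lam i)\<^sup>2)))"
proof -
  let ?M = "gaussian_product D"
  define x where "x i = (lam i)\<^sup>2" for i
  define g where "g = coord (A *\<^sub>v f)"
  define \<xi> where "\<xi> \<omega> = coord (noise D \<delta> \<omega>)" for \<omega>
  define G where "G \<omega> \<longleftrightarrow> (\<forall>i\<in>{1..D}. g i + \<xi> \<omega> i \<noteq> 0)" for \<omega>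
  define T where "T \<omega> = (if G \<omega> then cg_errors.balanced D x g (\<xi> \<omega>) else 0)" for \<omega>
  define err where "err \<omega> = cg_errors.approx D x g (\<xi> \<omega>) (T \<omega>) + cg_errors.stoch D x g (\<xi> \<omega>) (T \<omega>)" for \<omega>
  define ls where "ls \<omega> = cg_errors.loss D x g (\<xi> \<omega>) (T \<omega>)" for \<omega>
  have \<xi>_meas: "(\<lambda>\<omega>. \<xi> \<omega> i) \<in> borel_measurable ?M" for i
    unfolding \<xi>_def by (rule coord_noise_measurable)
  note [measurable] = \<xi>_meas
  have obs: "generic_observation D P A lam u f (noise D \<delta> \<omega>)" if "G \<omega>" for \<omega>
  proof unfold_locales
    show "f \<in> carrier_vec P" by (rule f)
    show "noise D \<delta> \<omega> \<in> carrier_vec D" by (rule noise_carrier)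
    fix i assume i: "i \<in> {1..D}"
    have "A *\<^sub>v f \<in> carrier_vec D" using A_carrier f by simp
    then have "(A *\<^sub>v f + noise D \<delta> \<omega>) \<bullet> u i = g i + \<xi> \<omega> i"
      unfolding scalar_prod_coord[OF i] by (simp add: coord_add noise_carrier g_def \<xi>_def)
    then show "(A *\<^sub>v f + noise D \<delta> \<omega>) \<bullet> u i \<noteq> 0" using that i by (simp add: G_def)
  qed
  have noise: "cg_noise D x g (\<xi> \<omega>)" if "G \<omega>" for \<omega>
    using generic_observation.is_cg_noise[OF obs[OF that]]
    by (simp add: x_def[abs_def] g_def \<xi>_def)
  have G_meas: "Measurable.pred ?M G" unfolding G_def by measurable
  have T_meas: "T \<in> borel_measurable ?M"
    unfolding T_def by (rule measurable_balanced[OF \<xi>_meas G_meas noise])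
  note errors_meas = measurable_cg_errors[OF \<xi>_meas T_meas]
  have [measurable]: "err \<in> borel_measurable ?M" "ls \<in> borel_measurable ?M"
    unfolding err_def ls_def using errors_meas by auto
  have G_AE: "AE \<omega> in ?M. G \<omega>"
    unfolding G_def
  proof (rule AE_finite_allI)
    fix i assume i: "i \<in> {1..D}"
    show "AE \<omega> in ?M. g i + \<xi> \<omega> i \<noteq> 0"
      using gauss.std_normal_facts(5)[OF distributed_u[OF i], of "- g i / \<delta>"]
    proof eventually_elim
      case (elim \<omega>)
      then show ?case using \<delta> by (auto simp: \<xi>_def coord_noise field_simps add_eq_0_iff)
    qed
  qed simp
  have err_eq: "AE \<omega> in ?M. oracle_err A lam u f (noise D \<delta> \<omega>) = err \<omega>"
    using G_AE
  proof eventually_elim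
    case (elim \<omega>)
    show ?case
      using generic_observation.oracle_err_eq[OF obs[OF elim]] elim
      by (simp add: err_def T_def x_def[abs_def] g_def \<xi>_def)
  qed
  have loss_eq: "AE \<omega> in ?M. cg_oracle_loss A lam u f (noise D \<delta> \<omega>) = ls \<omega>"
    using G_AE
  proof eventually_elim
    case (elim \<omega>)
    show ?case
      using generic_observation.cg_oracle_loss_eq[OF obs[OF elim]] elim
      by (simp add: ls_def T_def x_def[abs_def] g_def \<xi>_def)
  qed
  have ls_le: "AE \<omega> in ?M. 0 \<le> ls \<omega> \<and> ls \<omega> \<le> 2 * err \<omega>"
    using G_AE
  proof eventually_elim
    case (elim \<omega>)
    then show ?case
      using cg_noise.loss_le[OF noise[OF elim], of "T \<omega>"] cg_noise.loss_nonneg[OF noise[OF elim], of "T \<omega>"]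
      by (simp add: ls_def err_def)
  qed
  have err_le: "AE \<omega> in ?M. err \<omega> \<le> 2 * ((\<Sum>i=1..D. exp (- s * x i) * (g i)\<^sup>2)
      + (\<Sum>i=1..D. min 1 (s * x i) * (\<xi> \<omega> i)\<^sup>2))" if "0 \<le> s" for s
    using G_AE
  proof eventually_elim
    case (elim \<omega>)
    then show ?case
      using cg_noise.balanced_bound[OF noise[OF elim] that] by (simp add: err_def T_def)
  qed
  \<comment> \<open>At \<open>s = 0\<close> the pathwise bound is deterministic and serves as an
    integrable majorant.\<close>
  have err_int: "integrable ?M err"
  proof (rule Bochner_Integration.integrable_bound)
    show "integrable ?M (\<lambda>\<omega>. 2 * (\<Sum>i=1..D. (g i)\<^sup>2))" by simp
    show "AE \<omega> in ?M. norm (err \<omega>) \<le> norm (2 * (\<Sum>i=1..D. (g i)\<^sup>2))"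
      using err_le[OF order_refl] ls_le by eventually_elim simp
  qed simp
  have "AE \<omega> in ?M. norm (ls \<omega>) \<le> norm (2 * err \<omega>)"
    using ls_le by eventually_elim auto
  then have ls_int: "integrable ?M ls"
    by (intro Bochner_Integration.integrable_bound[of ?M "\<lambda>\<omega>. 2 * err \<omega>" ls] err_int integrable_mult_right)
       simp_all
  note err_tr = completion_AE_transfer[OF err_int err_eq]
  note ls_tr = completion_AE_transfer[OF ls_int loss_eq]
  show "integrable (std_gaussian D) (\<lambda>\<omega>. cg_oracle_loss A lam u f (noise D \<delta> \<omega>))"
    "integrable (std_gaussian D) (\<lambda>\<omega>. oracle_err A lam u f (noise D \<delta> \<omega>))"
    unfolding std_gaussian_eq by (rule ls_tr(1), rule err_tr(1))
  have "integral\<^sup>L ?M ls \<le> integral\<^sup>L ?M (\<lambda>\<omega>. 2 * err \<omega>)"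
    using ls_le by (intro integral_mono_AE ls_int integrable_mult_right err_int) (auto elim!: eventually_mono)
  then show "(\<integral>\<omega>. cg_oracle_loss A lam u f (noise D \<delta> \<omega>) \<partial>std_gaussian D)
      \<le> 2 * (\<integral>\<omega>. oracle_err A lam u f (noise D \<delta> \<omega>) \<partial>std_gaussian D)"
    unfolding std_gaussian_eq ls_tr(2) err_tr(2) by simp
  assume s: "0 \<le> s"
  have "integral\<^sup>L ?M err \<le> (\<integral>\<omega>. 2 * ((\<Sum>i=1..D. exp (- s * x i) * (g i)\<^sup>2)
      + (\<Sum>i=1..D. min 1 (s * x i) * (\<xi> \<omega> i)\<^sup>2)) \<partial>?M)"
    using coord_noise_moments(3)
    by (intro integral_mono_AE err_int err_le s integrable_mult_right Bochner_Integration.integrable_add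
        Bochner_Integration.integrable_sum) (simp_all add: \<xi>_def)
  also have "\<dots> = 2 * ((\<Sum>i=1..D. exp (- s * x i) * (g i)\<^sup>2) + (\<Sum>i=1..D. min 1 (s * x i) * \<delta>\<^sup>2))"
  proof -
    have "integrable ?M (\<lambda>\<omega>. \<Sum>i=1..D. min 1 (s * x i) * (\<xi> \<omega> i)\<^sup>2)"
      using coord_noise_moments(3)
      by (intro Bochner_Integration.integrable_sum integrable_mult_right) (simp_all add: \<xi>_def)
    moreover have "(\<integral>\<omega>. (\<Sum>i=1..D. min 1 (s * x i) * (\<xi> \<omega> i)\<^sup>2) \<partial>?M) = (\<Sum>i=1..D. min 1 (s * x i) * \<delta>\<^sup>2)"
      using coord_noise_moments(3,4)
      by (subst Bochner_Integration.integral_sum) (simp_all add: \<xi>_def)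
    ultimately show ?thesis
      by (subst integral_mult_right_zero, subst Bochner_Integration.integral_add) (simp_all add: gauss.prob_space)
  qed
  finally show "(\<integral>\<omega>. oracle_err A lam u f (noise D \<delta> \<omega>) \<partial>std_gaussian D)
      \<le> 2 * ((\<Sum>i=1..D. exp (- s * (lam i)\<^sup>2) * (coord (A *\<^sub>v f) i)\<^sup>2)
        + \<delta>\<^sup>2 * (\<Sum>i=1..D. min 1 (s * (lam i)\<^sup>2)))"
    unfolding std_gaussian_eq err_tr(2) by (simp add: x_def g_def sum_distrib_left mult.commute)
qed

end

section \<open>The oracle inequality\<close>

text \<open>In the constant, one factor 2 is on the left side and one comes from the pathwise bound.
  The remaining 9 covers both the 8 of \<open>sum_min_le_sum_square\<close> and the bound
  \<open>exp 2 <= 9\<close> for small \<open>s\<close>.\<close>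

lemma (in distinct_singular_system) oracle_inequality:
  assumes f: "f \<in> carrier_vec P" and \<delta>: "0 < \<delta>" and c: "0 \<le> c" and s: "0 \<le> s"
    and tail: "\<And>j. j \<in> {2..D} \<Longrightarrow> (\<Sum>i=j..D. (lam i)\<^sup>2) \<le> c * real j * (lam j)\<^sup>2"
  shows "2 * (\<integral>\<omega>. oracle_err A lam u f (noise D \<delta> \<omega>) \<partial>std_gaussian D)
    \<le> 36 * (1 + 2 * c) * showalter_risk A lam u f \<delta> s"
proof -
  let ?E = "\<integral>\<omega>. oracle_err A lam u f (noise D \<delta> \<omega>) \<partial>std_gaussian D"
  define bias where "bias s = (\<Sum>i=1..D. exp (- s * (lam i)\<^sup>2) * (coord (A *\<^sub>v f) i)\<^sup>2)" for s
  define var where "var = (\<Sum>i=1..D. (1 - exp (- s * (lam i)\<^sup>2))\<^sup>2)"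
  have risk: "showalter_risk A lam u f \<delta> s = bias (2 * s) + \<delta>\<^sup>2 * var"
    unfolding showalter_risk_eq[OF f] bias_def var_def ..
  have bias0: "0 \<le> bias s" for s unfolding bias_def by (intro sum_nonneg) simp
  have var0: "0 \<le> \<delta>\<^sup>2 * var" unfolding var_def by (intro mult_nonneg_nonneg sum_nonneg) simp_all
  have E: "?E \<le> 2 * (bias r + \<delta>\<^sup>2 * (\<Sum>i=1..D. min 1 (r * (lam i)\<^sup>2)))" if "0 \<le> r" for r
    using balanced_oracle_expectation(4)[OF f \<delta> that] by (simp add: bias_def)
  have dec: "(lam j)\<^sup>2 \<le> (lam i)\<^sup>2" if "i \<in> {1..D}" "j \<in> {1..D}" "i \<le> j" for i j
    using that lam_pos[of j] lam_distinct[of i j] by (cases "i = j") (auto intro!: power_mono)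
  have pos: "0 < (lam i)\<^sup>2" if "i \<in> {1..D}" for i using lam_pos[OF that] by simp
  show ?thesis
  proof (cases "1 \<le> s * (lam 1)\<^sup>2")
    case True
    have "(\<Sum>i=1..D. min 1 (2 * s * (lam i)\<^sup>2)) \<le> 8 * (1 + 2 * c) * var"
      unfolding var_def using D_pos c s True pos dec tail
      by (intro sum_min_le_sum_square) auto
    then have V: "\<delta>\<^sup>2 * (\<Sum>i=1..D. min 1 (2 * s * (lam i)\<^sup>2)) \<le> 8 * (1 + 2 * c) * (\<delta>\<^sup>2 * var)"
      using mult_left_mono[of _ _ "\<delta>\<^sup>2"] by (fastforce simp: mult.left_commute)
    have B: "bias (2 * s) \<le> 9 * (1 + 2 * c) * bias (2 * s)"
      using bias0[of "2 * s"] c by (simp add: mult_le_cancel_right1)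
    have W: "8 * (1 + 2 * c) * (\<delta>\<^sup>2 * var) \<le> 9 * (1 + 2 * c) * (\<delta>\<^sup>2 * var)"
      using var0 c by (intro mult_right_mono) auto
    have "?E \<le> 2 * (bias (2 * s) + \<delta>\<^sup>2 * (\<Sum>i=1..D. min 1 (2 * s * (lam i)\<^sup>2)))"
      by (rule E) (use s in simp)
    also have "\<dots> \<le> 2 * (9 * (1 + 2 * c) * bias (2 * s) + 9 * (1 + 2 * c) * (\<delta>\<^sup>2 * var))"
      by (intro mult_left_mono add_mono B order_trans[OF V W]) simp
    finally have "?E \<le> 2 * (9 * (1 + 2 * c) * bias (2 * s) + 9 * (1 + 2 * c) * (\<delta>\<^sup>2 * var))" .
    then show ?thesis unfolding risk by (simp add: algebra_simps)
  next
    case False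
    \<comment> \<open>For \<open>s * x 1 < 1\<close> every bias weight \<open>exp (- 2 s x)\<close>
      is at least \<open>exp (- 2)\<close>, so the bound at time 0 costs at most the factor
      \<open>exp 2\<close>.\<close>
    have "exp (2 :: real) \<le> 3\<^sup>2"
      using power_mono[OF exp_le, of 2] by (simp add: exp_double[symmetric])
    then have e9: "1 \<le> 9 * exp (- 2 :: real)" by (simp add: exp_minus field_simps)
    have "bias 0 \<le> 9 * bias (2 * s)"
      unfolding bias_def sum_distrib_left
    proof (intro sum_mono)
      fix i assume i: "i \<in> {1..D}"
      have "s * (lam i)\<^sup>2 \<le> s * (lam 1)\<^sup>2" using dec[of 1 i] i s by (intro mult_left_mono) auto
      then have "exp (- 2 :: real) \<le> exp (- (2 * s) * (lam i)\<^sup>2)" using False by simp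
      then have "1 \<le> 9 * exp (- (2 * s) * (lam i)\<^sup>2)" using e9 by linarith
      then show "exp (- 0 * (lam i)\<^sup>2) * (coord (A *\<^sub>v f) i)\<^sup>2
          \<le> 9 * (exp (- (2 * s) * (lam i)\<^sup>2) * (coord (A *\<^sub>v f) i)\<^sup>2)"
        using mult_right_mono[of 1 "9 * exp (- (2 * s) * (lam i)\<^sup>2)" "(coord (A *\<^sub>v f) i)\<^sup>2"] by simp
    qed
    then have "2 * ?E \<le> 36 * bias (2 * s)" using E[of 0] by simp
    also have "\<dots> \<le> 36 * showalter_risk A lam u f \<delta> s" unfolding risk using var0 by simp
    also have "\<dots> \<le> 36 * (1 + 2 * c) * showalter_risk A lam u f \<delta> s"
      unfolding risk using var0 bias0[of "2 * s"] c by (intro mult_right_mono) auto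
    finally show ?thesis .
  qed
qed

theorem mainTheorem8:
  fixes Clam :: real
  assumes "0 < Clam"
  shows "\<exists>C>0. \<forall>(D::nat) (P::nat) (A::real mat) (lam::nat \<Rightarrow> real) (u::nat \<Rightarrow> real vec) (f::real vec).
    3 \<le> D \<and> D \<le> P \<and> A \<in> carrier_mat D P \<and> vec_space.rank D A = D \<and>
    left_singular_system A lam u \<and>
    (\<forall>i\<in>{1..D}. \<forall>j\<in>{1..D}. i < j \<longrightarrow> lam j < lam i) \<and>
    (\<forall>j\<in>{2..D}. (\<Sum>i=j..D. (lam i)\<^sup>2) \<le> Clam * real j * (lam j)\<^sup>2) \<and>
    f \<in> carrier_vec P \<longrightarrow>
      (\<forall>\<delta>::real. 0 < \<delta> \<and> \<delta> < 1 \<longrightarrow>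
         integrable (std_gaussian D) (\<lambda>\<omega>. cg_oracle_loss A lam u f (noise D \<delta> \<omega>)) \<and>
         integrable (std_gaussian D) (\<lambda>\<omega>. oracle_err A lam u f (noise D \<delta> \<omega>)) \<and>
         (\<integral>\<omega>. cg_oracle_loss A lam u f (noise D \<delta> \<omega>) \<partial>std_gaussian D)
           \<le> 2 * (\<integral>\<omega>. oracle_err A lam u f (noise D \<delta> \<omega>) \<partial>std_gaussian D) \<and>
         2 * (\<integral>\<omega>. oracle_err A lam u f (noise D \<delta> \<omega>) \<partial>std_gaussian D)
           \<le> C * (INF s\<in>{s. s \<ge> 1 / (lam 1)\<^sup>2}. showalter_risk A lam u f \<delta> s)) \<and>
      (f \<noteq> 0\<^sub>v P \<longrightarrow>
         (\<exists>\<delta>\<^sub>0>0. \<forall>\<delta>::real. 0 < \<delta> \<and> \<delta> < 1 \<and> \<delta> < \<delta>\<^sub>0 \<longrightarrow>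
            2 * (\<integral>\<omega>. oracle_err A lam u f (noise D \<delta> \<omega>) \<partial>std_gaussian D)
              \<le> C * (INF s\<in>{s. s \<ge> 0}. showalter_risk A lam u f \<delta> s)))"
proof (rule exI[of _ "36 * (1 + 2 * Clam)"], intro conjI allI impI)
  show C_pos: "0 < 36 * (1 + 2 * Clam)" using assms by simp
  fix D P :: nat and A :: "real mat" and lam :: "nat \<Rightarrow> real" and u :: "nat \<Rightarrow> real vec" and f :: "real vec"
  assume *: "3 \<le> D \<and> D \<le> P \<and> A \<in> carrier_mat D P \<and> vec_space.rank D A = D \<and>
    left_singular_system A lam u \<and>
    (\<forall>i\<in>{1..D}. \<forall>j\<in>{1..D}. i < j \<longrightarrow> lam j < lam i) \<and>
    (\<forall>j\<in>{2..D}. (\<Sum>i=j..D. (lam i)\<^sup>2) \<le> Clam * real j * (lam j)\<^sup>2) \<and>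
    f \<in> carrier_vec P"
  then have f: "f \<in> carrier_vec P" by blast
  interpret distinct_singular_system D P A lam u
    by unfold_locales (use * in auto)
  let ?E = "\<lambda>\<delta>. \<integral>\<omega>. oracle_err A lam u f (noise D \<delta> \<omega>) \<partial>std_gaussian D"
  have inf: "2 * ?E \<delta> \<le> 36 * (1 + 2 * Clam) * (INF s\<in>S. showalter_risk A lam u f \<delta> s)"
    if "0 < \<delta>" "S \<noteq> {}" "S \<subseteq> {0..}" for \<delta> S
  proof -
    have "2 * ?E \<delta> \<le> 36 * (1 + 2 * Clam) * showalter_risk A lam u f \<delta> s" if "s \<in> S" for s
      using that \<open>S \<subseteq> {0..}\<close> \<open>0 < \<delta>\<close> assms f * by (intro oracle_inequality) auto
    then have "2 * ?E \<delta> / (36 * (1 + 2 * Clam)) \<le> (INF s\<in>S. showalter_risk A lam u f \<delta> s)"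
      using C_pos \<open>S \<noteq> {}\<close> by (intro cINF_greatest) (auto simp: pos_divide_le_eq mult.commute)
    then show ?thesis using C_pos by (simp add: pos_divide_le_eq mult.commute)
  qed
  show "\<exists>\<delta>\<^sub>0>0. \<forall>\<delta>::real. 0 < \<delta> \<and> \<delta> < 1 \<and> \<delta> < \<delta>\<^sub>0 \<longrightarrow>
      2 * ?E \<delta> \<le> 36 * (1 + 2 * Clam) * (INF s\<in>{s. s \<ge> 0}. showalter_risk A lam u f \<delta> s)"
    \<comment> \<open>\<open>oracle_inequality\<close> covers all \<open>s >= 0\<close> for each
      positive \<open>\<delta>\<close>, so 1 serves as the threshold.\<close>
    by (intro exI[of _ 1] conjI allI impI inf) auto
  fix \<delta> :: real assume \<delta>: "0 < \<delta> \<and> \<delta> < 1"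
  then show "integrable (std_gaussian D) (\<lambda>\<omega>. cg_oracle_loss A lam u f (noise D \<delta> \<omega>))"
    "integrable (std_gaussian D) (\<lambda>\<omega>. oracle_err A lam u f (noise D \<delta> \<omega>))"
    "(\<integral>\<omega>. cg_oracle_loss A lam u f (noise D \<delta> \<omega>) \<partial>std_gaussian D) \<le> 2 * ?E \<delta>"
    using balanced_oracle_expectation[OF f] by auto
  have "0 \<le> 1 / (lam 1)\<^sup>2" by simp
  then have "{s. 1 / (lam 1)\<^sup>2 \<le> s} \<subseteq> {0..}" by (intro subsetI, unfold mem_Collect_eq atLeast_iff, rule order_trans)
  then show "2 * ?E \<delta> \<le> 36 * (1 + 2 * Clam) * (INF s\<in>{s. s \<ge> 1 / (lam 1)\<^sup>2}. showalter_risk A lam u f \<delta> s)"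
    using \<delta> by (intro inf) auto
qed

end
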